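(* Let $n,t\ge1$ be integers, let $M\in\mathrm{Herm}(\mathbb C^n\otimes\mathbb C^n)$, and set $\tau=\lfloor (t+1)/2\rfloor$. The following assertions are equivalent. (i) $M\in(\widetilde{\mathrm{DPS}}^{(t)}_n)^*$. (ii) The polynomial $\|x\|^{2(t-1)}\langle M,xx^*\otimes xx^*\rangle\in\mathbb C[x,\overline x]$ (homogeneous of degree $t+1$ in $x$ and of degree $t+1$ in $\overline x$) is r-sos. (iii) There exist matrices $B,W_0,W_1,\ldots,W_\tau\in\mathrm{Herm}(\mathbb C^n\otimes(\mathbb C^n)^{\otimes t})$ such that $$M\otimes I_n^{\otimes(t-1)}=B+\sum_{s=0}^{\tau}W_s,$$ where $B\in\mathrm{Herm}(S^{t+1}(\mathbb C^n))^\perp$ and $W_s\in\mathcal W^{(t)}_{n,s}$ for $s=0,1,\ldots,\tau$.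
   Context: $\mathrm{Herm}(V)$ denotes the Hermitian matrices acting on $V$, with inner product $\langle X,Y\rangle=\mathrm{Tr}(X^*Y)$; $I_n$ is the identity matrix. Matrices in $\mathrm{Herm}((\mathbb C^n)^{\otimes(t+1)})=\mathrm{Herm}(\mathbb C^n\otimes(\mathbb C^n)^{\otimes t})$ are indexed by $[n]^{t+1}$, whose elements are written $i_0\underline i$, $i_0\in[n]$, $\underline i\in[n]^t$. $\mathrm{Herm}(S^{t+1}(\mathbb C^n))$ is identified with the space of Bose symmetric matrices $\mathrm{BS}((\mathbb C^n)^{\otimes(t+1)})$: the $\rho\in\mathrm{Herm}((\mathbb C^n)^{\otimes(t+1)})$ with $\rho_{\underline i,\underline j}=\rho_{\underline i,\underline j^\sigma}$ for all $\underline i,\underline j\in[n]^{t+1}$, $\sigma\in\mathfrak S_{t+1}$, where $\underline j^\sigma$ is obtained by permuting the positions of $\underline j$ by $\sigma$ (equivalently $\rho=\Pi\rho\Pi$ with $\Pi$ the orthogonal projector onto the symmetric subspace $S^{t+1}(\mathbb C^n)$). Its orthogonal complement $\mathrm{Herm}(S^{t+1}(\mathbb C^n))^\perp$ is taken in $\mathrm{Herm}((\mathbb C^n)^{\otimes(t+1)})$ for the trace inner product. For $0\le s\le t$, the partial transpose is $(\rho^{T_{B[s]}})_{i_0\underline h\,\underline i,\ j_0\underline k\,\underline j}=\rho_{i_0\underline k\,\underline i,\ j_0\underline h\,\underline j}$ ($\underline h,\underline k\in[n]^s$, $\underline i,\underline j\in[n]^{t-s}$), and $\mathcal W^{(t)}_{n,s}=\{\rho\in\mathrm{Herm}(\mathbb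 C^n\otimes(\mathbb C^n)^{\otimes t}):\rho^{T_{B[s]}}\succeq0\}$. The partial trace is $(\mathrm{Tr}_{B[2:t]}(\rho))_{ij,kl}=\sum_{\underline h\in[n]^{t-1}}\rho_{ij\underline h,kl\underline h}$. $\widetilde{\mathrm{DPS}}^{(t)}_n$ is the set of $\rho_{AB}\in\mathrm{Herm}(\mathbb C^n\otimes\mathbb C^n)$ for which there exists $\rho_{AB[t]}\in\mathrm{BS}((\mathbb C^n)^{\otimes(t+1)})$ with $\rho_{AB[t]}^{T_{B[s]}}\succeq0$ for $s=0,1,\ldots,\lfloor(t+1)/2\rfloor$ and $\mathrm{Tr}_{B[2:t]}(\rho_{AB[t]})=\rho_{AB}$. Its dual cone is $(\widetilde{\mathrm{DPS}}^{(t)}_n)^*=\{M\in\mathrm{Herm}(\mathbb C^n\otimes\mathbb C^n):\langle M,\rho_{AB}\rangle\ge0\ \forall\rho_{AB}\in\widetilde{\mathrm{DPS}}^{(t)}_n\}$. $\mathbb C[x,\overline x]$ is the ring of polynomials in complex variables $x=(x_1,\ldots,x_n)$ and their conjugates; $\|x\|^2=\sum_i x_i\overline{x_i}$. A polynomial $q$ is Hermitian if $q=\overline q$; $p$ is r-sos (real-sum of squares) if $p=\sum_{\ell=1}^m q_\ell^2$ for some Hermitian $q_\ell\in\mathbb C[x,\overline x]$ (equivalently $p=\sum_\ell h_\ell\overline{h_\ell}$ with $h_\ell\in\mathbb C[x,\overline x]$). *)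

theory Defs
  imports
    "HOL-Analysis.Analysis"
    "HOL-Combinatorics.Permutations"
    "HOL-Library.Poly_Mapping"
    "HOL-Library.Complex_Order"
begin

text \<open>
  The index set \<open>[n]\<close> is a finite type \<^typ>\<open>'n\<close> and \<open>[n]\<^sup>k\<close> is the set of lists of length \<open>k\<close>.
  A matrix acting on the \<open>k\<close>-fold tensor power of \<open>\<complex>\<^sup>n\<close> is a function of two such lists that
  vanishes as soon as one of its arguments does not have length \<open>k\<close>; hence equality of functions
  is equality of matrices.
\<close>

type_synonym ('n, 'a) tmat = "'n list \<Rightarrow> 'n list \<Rightarrow> 'a"

definition tuples :: "nat \<Rightarrow> 'n::finite list set" where
  "tuples k = {a. length a = k}"

definition Herm :: "nat \<Rightarrow> ('n::finite, complex) tmat set" where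
  "Herm k = {X. (\<forall>a b. a \<notin> tuples k \<or> b \<notin> tuples k \<longrightarrow> X a b = 0) \<and>
                (\<forall>a\<in>tuples k. \<forall>b\<in>tuples k. X a b = cnj (X b a))}"

definition hs_inner :: "nat \<Rightarrow> ('n::finite, complex) tmat \<Rightarrow> ('n, complex) tmat \<Rightarrow> complex" where
  "hs_inner k X Y = (\<Sum>a\<in>tuples k. \<Sum>b\<in>tuples k. cnj (X a b) * Y a b)"

text \<open>The order on \<^typ>\<open>complex\<close> used from here on is the one in which \<open>0 \<le> z\<close> means
  that \<open>z\<close> is real and nonnegative.\<close>

definition psd :: "nat \<Rightarrow> ('n::finite, complex) tmat \<Rightarrow> bool" where
  "psd k X \<longleftrightarrow> X \<in> Herm k \<and>
     (\<forall>v :: 'n list \<Rightarrow> complex. 0 \<le> (\<Sum>a\<in>tuples k. \<Sum>b\<in>tuples k. cnj (v a) * X a b * v b))"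

text \<open>Tensor product of a matrix \<open>X\<close> acting on the \<open>k\<close>-fold tensor power with a matrix \<open>Y\<close>.\<close>

definition tensor :: "nat \<Rightarrow> ('n, 'a::times) tmat \<Rightarrow> ('n, 'a) tmat \<Rightarrow> ('n, 'a) tmat" where
  "tensor k X Y = (\<lambda>a b. X (take k a) (take k b) * Y (drop k a) (drop k b))"

definition id_mat :: "nat \<Rightarrow> ('n::finite, complex) tmat" where
  "id_mat k = (\<lambda>a b. if a \<in> tuples k \<and> a = b then 1 else 0)"

primrec tensor_power :: "('n::finite, complex) tmat \<Rightarrow> nat \<Rightarrow> ('n, complex) tmat" where
  "tensor_power X 0 = id_mat 0"
| "tensor_power X (Suc k) = tensor 1 X (tensor_power X k)"

definition BS :: "nat \<Rightarrow> ('n::finite, complex) tmat set" where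
  "BS k = {\<rho> \<in> Herm k. \<forall>a\<in>tuples k. \<forall>b\<in>tuples k. \<forall>\<sigma>. \<sigma> permutes {..<k} \<longrightarrow>
             \<rho> a b = \<rho> a (permute_list \<sigma> b)}"

definition BS_perp :: "nat \<Rightarrow> ('n::finite, complex) tmat set" where
  "BS_perp k = {B \<in> Herm k. \<forall>\<rho>\<in>BS k. hs_inner k B \<rho> = 0}"

text \<open>The positions \<open>1, \<dots>, s\<close> (position \<open>0\<close> is the factor \<open>A\<close>) of the row index and of the
  column index are exchanged.\<close>

definition ptranspose :: "nat \<Rightarrow> nat \<Rightarrow> ('n::finite, complex) tmat \<Rightarrow> ('n, complex) tmat" where
  "ptranspose t s \<rho> = (\<lambda>a b.
     if a \<in> tuples (t + 1) \<and> b \<in> tuples (t + 1)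
     then \<rho> (take 1 a @ take s (drop 1 b) @ drop (1 + s) a)
            (take 1 b @ take s (drop 1 a) @ drop (1 + s) b)
     else 0)"

definition \<W> :: "nat \<Rightarrow> nat \<Rightarrow> ('n::finite, complex) tmat set" where
  "\<W> t s = {\<rho> \<in> Herm (t + 1). psd (t + 1) (ptranspose t s \<rho>)}"

definition ptrace :: "nat \<Rightarrow> ('n::finite, complex) tmat \<Rightarrow> ('n, complex) tmat" where
  "ptrace t \<rho> = (\<lambda>a b. if a \<in> tuples 2 \<and> b \<in> tuples 2
                       then \<Sum>h\<in>tuples (t - 1). \<rho> (a @ h) (b @ h) else 0)"

definition DPS :: "nat \<Rightarrow> ('n::finite, complex) tmat set" where
  "DPS t = {\<rho>AB \<in> Herm 2. \<exists>\<rho>\<in>BS (t + 1).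
              (\<forall>s\<le>(t + 1) div 2. psd (t + 1) (ptranspose t s \<rho>)) \<and> ptrace t \<rho> = \<rho>AB}"

definition DPS_dual :: "nat \<Rightarrow> ('n::finite, complex) tmat set" where
  "DPS_dual t = {M \<in> Herm 2. \<forall>\<rho>AB\<in>DPS t. 0 \<le> hs_inner 2 M \<rho>AB}"

text \<open>
  The polynomial ring \<open>\<complex>[x, x\<^sup>*]\<close>: the variable \<open>Inl i\<close> is \<open>x\<^sub>i\<close> and the variable \<open>Inr i\<close> is its
  formal conjugate. Ring operations are those of the convolution product on \<open>\<Rightarrow>\<^sub>0\<close>.
\<close>

type_synonym 'n cpoly = "(('n + 'n) \<Rightarrow>\<^sub>0 nat) \<Rightarrow>\<^sub>0 complex"

definition Const :: "complex \<Rightarrow> 'n cpoly" where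
  "Const c = Poly_Mapping.single 0 c"

definition Var :: "'n \<Rightarrow> 'n cpoly" where
  "Var i = Poly_Mapping.single (Poly_Mapping.single (Inl i) 1) 1"

definition Var_conj :: "'n \<Rightarrow> 'n cpoly" where
  "Var_conj i = Poly_Mapping.single (Poly_Mapping.single (Inr i) 1) 1"

definition swap_var :: "'n + 'n \<Rightarrow> 'n + 'n" where
  "swap_var = case_sum Inr Inl"

definition swap_monom :: "(('n + 'n) \<Rightarrow>\<^sub>0 nat) \<Rightarrow> (('n + 'n) \<Rightarrow>\<^sub>0 nat)" where
  "swap_monom m = Poly_Mapping.map_key swap_var m"

definition conj_poly :: "'n cpoly \<Rightarrow> 'n cpoly" where
  "conj_poly q = Poly_Mapping.map cnj (Poly_Mapping.map_key swap_monom q)"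

lemma swap_var_swap_var [simp]: "swap_var (swap_var v) = v"
  by (cases v) (auto simp: swap_var_def)

lemma inj_swap_var: "inj swap_var"
  by (rule inj_on_inverseI[where g = swap_var]) simp

lemma lookup_swap_monom: "Poly_Mapping.lookup (swap_monom m) v = Poly_Mapping.lookup m (swap_var v)"
  by (simp add: swap_monom_def Poly_Mapping.map_key.rep_eq inj_swap_var)

lemma swap_monom_swap_monom [simp]: "swap_monom (swap_monom m) = m"
  by (rule poly_mapping_eqI) (simp add: lookup_swap_monom)

lemma inj_swap_monom: "inj swap_monom"
  by (rule inj_on_inverseI[where g = swap_monom]) simp

text \<open>The library's \<open>map_key f\<close> is meaningful only for injective \<open>f\<close>; here this gives
  the expected coefficients.\<close>

lemma lookup_conj_poly: "Poly_Mapping.lookup (conj_poly q) m = cnj (Poly_Mapping.lookup q (swap_monom m))"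
  by (simp add: conj_poly_def Poly_Mapping.map.rep_eq Poly_Mapping.map_key.rep_eq inj_swap_monom when_def)

definition hermitian_poly :: "'n cpoly \<Rightarrow> bool" where
  "hermitian_poly q \<longleftrightarrow> conj_poly q = q"

definition r_sos :: "'n cpoly \<Rightarrow> bool" where
  "r_sos p \<longleftrightarrow> (\<exists>(m::nat) q. (\<forall>l<m. hermitian_poly (q l)) \<and> p = (\<Sum>l<m. (q l)\<^sup>2))"

definition norm_sq_poly :: "'n::finite cpoly" where
  "norm_sq_poly = (\<Sum>i\<in>UNIV. Var i * Var_conj i)"

definition xx_star :: "('n::finite, 'n cpoly) tmat" where
  "xx_star = (\<lambda>a b. if a \<in> tuples 1 \<and> b \<in> tuples 1 then Var (hd a) * Var_conj (hd b) else 0)"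

text \<open>The trace inner product of \<open>M\<close> with the matrix of polynomials \<open>xx\<^sup>* \<otimes> xx\<^sup>*\<close>.\<close>

definition form_poly :: "('n::finite, complex) tmat \<Rightarrow> 'n cpoly" where
  "form_poly M = (\<Sum>a\<in>tuples 2. \<Sum>b\<in>tuples 2. Const (cnj (M a b)) * tensor 1 xx_star xx_star a b)"

end

theory Submission
  imports Defs "HOL-Computational_Algebra.Polynomial"
begin

text \<open>
  Let \<open>N = M \<otimes> I\<close>. The polynomial of the theorem is the function \<open>x \<mapsto> \<langle>x\<^sup>\<otimes>\<^sup>k, N x\<^sup>\<otimes>\<^sup>k\<rangle>\<close> with \<open>k = t + 1\<close>; a matrix
  belongs to the orthogonal complement of the Bose symmetric matrices iff its function vanishes,
  and partial transposition turns the form at \<open>x\<^sup>\<otimes>\<^sup>k\<close> into the form at the vector \<open>w\<^sub>s(x)\<close> in which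
  \<open>s\<close> factors are conjugated. Hence (iii) says that the function of \<open>N\<close> is a sum of terms
  \<open>\<langle>w\<^sub>s(x), Z\<^sub>s w\<^sub>s(x)\<rangle>\<close> with \<open>Z\<^sub>s\<close> positive semidefinite.

  Factoring \<open>Z\<^sub>s\<close> gives a sum of squares. Conversely, in a sum of squares only the components of total
  degree \<open>k\<close> survive (growth along real rays), and averaging over phases leaves the squared moduli
  of their parts of bidegree \<open>(k - s, s)\<close>, where Hermitian symmetry allows \<open>s \<le> \<tau>\<close>.

  For (i) implies (iii), restrict to a finite set of points that determines the function of a
  matrix, and minimise the squared distance from the function of \<open>N\<close> to the cone of sums of such
  terms. The minimum is attained because the Gram kernels are bounded by their diagonals. The
  residual \<open>r\<close> yields the matrix \<open>- \<Sum>\<^sub>x r(x) (xx\<^sup>*)\<^sup>\<otimes>\<^sup>k\<close>, which is feasible for the DPS relaxation, and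
  pairing it with \<open>M\<close> forces \<open>r = 0\<close>.
\<close>

section \<open>Positive forms\<close>

definition qform :: "'a set \<Rightarrow> ('a \<Rightarrow> 'a \<Rightarrow> complex) \<Rightarrow> ('a \<Rightarrow> complex) \<Rightarrow> complex" where
  "qform A Z v = (\<Sum>a\<in>A. \<Sum>b\<in>A. cnj (v a) * Z a b * v b)"

text \<open>The order on \<open>complex\<close> makes every value real; for finite \<open>A\<close>,
  Hermitian symmetry of \<open>Z\<close> on \<open>A\<close> then follows by polarization.\<close>

definition pos_form :: "'a set \<Rightarrow> ('a \<Rightarrow> 'a \<Rightarrow> complex) \<Rightarrow> bool" where
  "pos_form A Z \<longleftrightarrow> (\<forall>v. 0 \<le> qform A Z v)"

lemma qform_mono_neutral:
  assumes "finite A" "B \<subseteq> A" "\<And>a. a \<in> A - B \<Longrightarrow> v a = 0"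
  shows "qform A Z v = qform B Z v"
proof -
  have "(\<Sum>b\<in>A. cnj (v a) * Z a b * v b) = (\<Sum>b\<in>B. cnj (v a) * Z a b * v b)" for a
    using assms by (intro sum.mono_neutral_right) auto
  moreover have "(\<Sum>a\<in>A. \<Sum>b\<in>B. cnj (v a) * Z a b * v b) = (\<Sum>a\<in>B. \<Sum>b\<in>B. cnj (v a) * Z a b * v b)"
    using assms by (intro sum.mono_neutral_right) auto
  ultimately show ?thesis by (simp add: qform_def)
qed

lemma pos_form_subset:
  assumes "pos_form A Z" "finite A" "B \<subseteq> A"
  shows "pos_form B Z"
  unfolding pos_form_def
proof
  fix v
  have "qform A Z (\<lambda>a. if a \<in> B then v a else 0) = qform B Z (\<lambda>a. if a \<in> B then v a else 0)"
    using assms by (intro qform_mono_neutral) auto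
  also have "\<dots> = qform B Z v" by (simp add: qform_def)
  finally show "0 \<le> qform B Z v" using assms(1) unfolding pos_form_def by metis
qed

lemma pos_form_diag:
  assumes "pos_form A Z" "finite A" "a \<in> A"
  shows "0 \<le> Z a a"
proof -
  have "pos_form {a} Z" using assms by (intro pos_form_subset[OF assms(1)]) auto
  then have "0 \<le> qform {a} Z (\<lambda>_. 1)" by (simp only: pos_form_def)
  then show ?thesis by (simp add: qform_def)
qed

text \<open>The value at the vector with entry 1 at \<open>a\<close> and \<open>z\<close> at
  \<open>b\<close>. Fourth roots of unity as \<open>z\<close> separate the real and imaginary parts
  of the off-diagonal entries.\<close>

lemma pos_form_two:
  assumes "pos_form A Z" "finite A" "a \<in> A" "b \<in> A" "a \<noteq> b"
  shows "0 \<le> Z a a + z * Z a b + cnj z * Z b a + cnj z * z * Z b b"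
proof -
  have "pos_form {a, b} Z" using assms by (intro pos_form_subset[OF assms(1)]) auto
  then have "0 \<le> qform {a, b} Z (\<lambda>c. if c = a then 1 else z)" by (simp only: pos_form_def)
  then show ?thesis using assms by (simp add: qform_def algebra_simps)
qed

lemma pos_form_hermitian:
  assumes "pos_form A Z" "finite A" "a \<in> A" "b \<in> A"
  shows "Z a b = cnj (Z b a)"
proof (cases "a = b")
  case True
  then show ?thesis using pos_form_diag[OF assms(1-3)]
    by (auto simp: less_eq_complex_def complex_eq_iff)
next
  case False
  have "Im (Z a a) = 0" "Im (Z b b) = 0"
    using pos_form_diag[OF assms(1,2)] assms(3,4) by (auto simp: less_eq_complex_def)
  then show ?thesis
    using pos_form_two[OF assms False, of 1] pos_form_two[OF assms False, of \<i>]
    by (auto simp: less_eq_complex_def complex_eq_iff)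
qed

text \<open>The tests at 1, -1, i and -i bound the real and the imaginary part of
  \<open>Z a b\<close> each by half the sum of the two diagonal entries. Compactness of the Gram
  kernels rests on this crude bound.\<close>

lemma pos_form_bound:
  assumes "pos_form A Z" "finite A" "a \<in> A" "b \<in> A"
  shows "cmod (Z a b) \<le> Re (Z a a) + Re (Z b b)"
proof (cases "a = b")
  case True
  then show ?thesis using pos_form_diag[OF assms(1-3)]
    by (auto simp: less_eq_complex_def cmod_def)
next
  case False
  have "Z b a = cnj (Z a b)" using pos_form_hermitian[OF assms] by simp
  then have "\<bar>Re (Z a b)\<bar> + \<bar>Im (Z a b)\<bar> \<le> Re (Z a a) + Re (Z b b)"
    using pos_form_two[OF assms False, of 1] pos_form_two[OF assms False, of \<i>]
       pos_form_two[OF assms False, of "-1"] pos_form_two[OF assms False, of "-\<i>"]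
    by (auto simp: less_eq_complex_def)
  then show ?thesis using cmod_le[of "Z a b"] by linarith
qed

text \<open>If the diagonal entry at \<open>c\<close> vanishes, the form at
  \<open>e_a + z e_c\<close> is affine in \<open>z\<close> over the reals, and an affine function
  bounded below is constant.\<close>

lemma pos_form_zero_diag:
  assumes "pos_form A Z" "finite A" "a \<in> A" "c \<in> A" "Z c c = 0"
  shows "Z a c = 0"
proof (cases "a = c")
  case False
  define w where "w = (cmod (Z a c))\<^sup>2"
  have ca: "Z c a = cnj (Z a c)" using pos_form_hermitian[OF assms(1,2,4,3)] .
  have "2 * l * w \<le> Re (Z a a)" for l :: real
  proof -
    have "0 \<le> Re (Z a a + (- of_real l * cnj (Z a c)) * Z a c + cnj (- of_real l * cnj (Z a c)) * Z c a)"
      using pos_form_two[OF assms(1-4) False, of "- of_real l * cnj (Z a c)"] assms(5)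
      by (simp add: less_eq_complex_def)
    then show ?thesis unfolding ca w_def cmod_power2
      by (simp add: algebra_simps power2_eq_square)
  qed
  from this[of "(Re (Z a a) + 1) / w"] have "w = 0"
    using pos_form_diag[OF assms(1-3)]
    by (cases "w = 0") (auto simp: less_eq_complex_def)
  then show ?thesis by (simp add: w_def)
qed (use assms in simp)

lemma pos_form_Schur_complement:
  assumes "pos_form (insert c A) Z" "finite A" "c \<notin> A" "Z c c \<noteq> 0"
  shows "pos_form A (\<lambda>a b. Z a b - Z a c * Z c b / Z c c)"
  unfolding pos_form_def
proof
  fix v :: "'a \<Rightarrow> complex"
  define S where "S = (\<Sum>b\<in>A. Z c b * v b)"
  \<comment> \<open>This entry at \<open>c\<close> minimises the form for fixed \<open>v\<close> on
    \<open>A\<close>; completing the square leaves the Schur complement.\<close>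
  define u where "u = v(c := - S / Z c c)"
  have herm: "Z a b = cnj (Z b a)" if "a \<in> insert c A" "b \<in> insert c A" for a b
    using assms(2) by (intro pos_form_hermitian[OF assms(1) _ that]) simp
  have S': "cnj S = (\<Sum>a\<in>A. cnj (v a) * Z a c)"
    unfolding S_def cnj_sum
    by (intro sum.cong) (simp_all add: herm[of c])
  have cc: "cnj (Z c c) = Z c c" using herm[of c c] by simp
  have u: "u a = v a" if "a \<in> A" for a using that assms(3) by (auto simp: u_def)
  have uc: "u c = - S / Z c c" by (simp add: u_def)
  have "qform (insert c A) Z u = cnj (u c) * Z c c * u c + cnj (u c) * S + cnj S * u c + qform A Z v"
    using assms(2,3) unfolding S'
    by (simp add: qform_def sum.distrib u S_def sum_distrib_left sum_distrib_right mult.assoc)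
  also have "\<dots> = qform A Z v - cnj S * S / Z c c"
    using assms(4) by (simp add: uc cc field_simps)
  also have "\<dots> = qform A (\<lambda>a b. Z a b - Z a c * Z c b / Z c c) v"
    unfolding S' unfolding S_def qform_def sum_product sum_divide_distrib
    by (simp add: algebra_simps sum_subtractf)
  finally show "0 \<le> qform A (\<lambda>a b. Z a b - Z a c * Z c b / Z c c) v"
    using assms(1) unfolding pos_form_def by metis
qed

text \<open>Cholesky factorization by induction on \<open>A\<close>: a zero pivot forces its row and
  column to vanish, and a positive pivot splits off one rank-one term and leaves the Schur
  complement.\<close>

lemma pos_form_factor:
  assumes "finite A" "pos_form A Z"
  shows "\<exists>(m::nat) g. \<forall>a\<in>A. \<forall>b\<in>A. Z a b = (\<Sum>l<m. g l a * cnj (g l b))"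
  using assms
proof (induction A arbitrary: Z rule: finite_induct)
  case (insert c A)
  have fin: "finite (insert c A)" using insert by simp
  have herm: "Z a b = cnj (Z b a)" if "a \<in> insert c A" "b \<in> insert c A" for a b
    by (rule pos_form_hermitian[OF insert.prems fin that])
  show ?case
  proof (cases "Z c c = 0")
    case True
    have z: "Z a c = 0" if "a \<in> insert c A" for a
      using pos_form_zero_diag[OF insert.prems fin that _ True] by simp
    then have z': "Z c a = 0" if "a \<in> insert c A" for a using herm[of c a] that by simp
    have "pos_form A Z" using pos_form_subset[OF insert.prems fin] by auto
    from insert.IH[OF this] obtain m :: nat and g where
      g: "\<forall>a\<in>A. \<forall>b\<in>A. Z a b = (\<Sum>l<m. g l a * cnj (g l b))" by auto
    show ?thesis
      using g z z' \<open>c \<notin> A\<close>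
      by (intro exI[of _ m] exI[of _ "\<lambda>l a. if a = c then 0 else g l a"])
         (auto intro!: sum.cong)
  next
    case False
    have "0 \<le> Z c c" using pos_form_diag[OF insert.prems fin] by simp
    define d where "d = Re (Z c c)"
    have d: "Z c c = of_real d" "d > 0"
      using \<open>0 \<le> Z c c\<close> False by (auto simp: d_def less_eq_complex_def complex_eq_iff)
    from insert.IH[OF pos_form_Schur_complement[OF insert.prems insert.hyps False]]
    obtain m :: nat and g where
      g: "\<forall>a\<in>A. \<forall>b\<in>A. Z a b - Z a c * Z c b / Z c c = (\<Sum>l<m. g l a * cnj (g l b))" by auto
    \<comment> \<open>The new vector is the pivot column divided by the square root of the pivot;
      the old ones get the entry 0 at \<open>c\<close>.\<close>
    define g' where "g' l a = (if l = m then Z a c / of_real (sqrt d) else if a = c then 0 else g l a)"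
      for l a
    have m: "g' m a * cnj (g' m b) = Z a c * Z c b / Z c c" if "b \<in> insert c A" for a b
    proof -
      have "of_real (sqrt d) * of_real (sqrt d) = (of_real d :: complex)"
        using d(2) by (simp flip: of_real_mult)
      then show ?thesis using herm[of c b] that by (simp add: g'_def d(1))
    qed
    have "Z a b = (\<Sum>l<Suc m. g' l a * cnj (g' l b))" if "a \<in> insert c A" "b \<in> insert c A" for a b
    proof -
      have "(\<Sum>l<m. g' l a * cnj (g' l b)) = Z a b - Z a c * Z c b / Z c c"
        using g that False insert.hyps by (auto simp: g'_def intro!: sum.cong)
      then show ?thesis using m[OF that(2), of a] by simp
    qed
    then show ?thesis by blast
  qed
qed simp

lemma qform_rank_one_sum:
  assumes "\<And>a b. a \<in> A \<Longrightarrow> b \<in> A \<Longrightarrow> Z a b = (\<Sum>l\<in>L. g l a * cnj (g l b))"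
  shows "qform A Z v = (\<Sum>l\<in>L. of_real ((cmod (\<Sum>a\<in>A. cnj (g l a) * v a))\<^sup>2))"
proof -
  have "qform A Z v = (\<Sum>a\<in>A. \<Sum>b\<in>A. \<Sum>l\<in>L. (cnj (v a) * g l a) * (cnj (g l b) * v b))"
    unfolding qform_def using assms
    by (intro sum.cong) (auto simp: sum_distrib_left sum_distrib_right mult.assoc)
  also have "\<dots> = (\<Sum>l\<in>L. \<Sum>a\<in>A. \<Sum>b\<in>A. (cnj (v a) * g l a) * (cnj (g l b) * v b))"
    by (subst sum.swap[of _ L]) (simp add: sum.swap[of _ L])
  also have "\<dots> = (\<Sum>l\<in>L. cnj (\<Sum>a\<in>A. cnj (g l a) * v a) * (\<Sum>a\<in>A. cnj (g l a) * v a))"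
    unfolding cnj_sum sum_product by (simp add: mult.commute[of "cnj (v _)"])
  finally show ?thesis by (simp only: complex_norm_square mult.commute)
qed

section \<open>Duality for cones of Gram forms\<close>

text \<open>The form of \<open>T^* K T\<close> at \<open>v\<close> is that of \<open>K\<close> at
  \<open>T v\<close>. This serves in both directions: from kernels on \<open>A\<close> to Gram
  kernels on points, and back by interpolation weights.\<close>

lemma qform_congruence:
  "qform A (\<lambda>a b. \<Sum>x\<in>E. \<Sum>y\<in>E. cnj (T x a) * K x y * T y b) v = qform E K (\<lambda>x. \<Sum>b\<in>A. T x b * v b)"
proof -
  have "qform A (\<lambda>a b. \<Sum>x\<in>E. \<Sum>y\<in>E. cnj (T x a) * K x y * T y b) v =
      (\<Sum>a\<in>A. \<Sum>b\<in>A. \<Sum>x\<in>E. \<Sum>y\<in>E. cnj (T x a * v a) * K x y * (T y b * v b))"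
    by (simp add: qform_def sum_distrib_left sum_distrib_right mult_ac)
  also have "\<dots> = (\<Sum>x\<in>E. \<Sum>y\<in>E. \<Sum>a\<in>A. \<Sum>b\<in>A. cnj (T x a * v a) * K x y * (T y b * v b))"
    by (simp add: sum.swap[of _ A E])
  also have "\<dots> = (\<Sum>x\<in>E. \<Sum>y\<in>E. cnj (\<Sum>b\<in>A. T x b * v b) * K x y * (\<Sum>b\<in>A. T y b * v b))"
    by (simp add: sum_distrib_left sum_distrib_right mult_ac)
  finally show ?thesis by (simp add: qform_def)
qed

lemma pos_form_congruence:
  "pos_form E K \<Longrightarrow> pos_form A (\<lambda>a b. \<Sum>x\<in>E. \<Sum>y\<in>E. cnj (T x a) * K x y * T y b)"
  by (simp add: pos_form_def qform_congruence)

text \<open>A generalized inverse of the evaluation map: every function in the span of the \<open>w a\<close> is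
  recovered linearly from its values at finitely many points.\<close>

lemma finite_family_interpolation:
  fixes w :: "'a \<Rightarrow> 'x \<Rightarrow> complex"
  assumes "finite A"
  shows "\<exists>E lam. finite E \<and> E \<subseteq> X \<and>
           (\<forall>b\<in>A. \<forall>y\<in>X. w b y = (\<Sum>a\<in>A. (\<Sum>x\<in>E. lam a x * w b x) * w a y))"
  using assms
proof (induction A rule: finite_induct)
  case empty
  then show ?case by (intro exI[of _ "{}"]) auto
next
  case (insert c A)
  then obtain E lam where E: "finite E" "E \<subseteq> X"
    and IH: "\<And>b y. b \<in> A \<Longrightarrow> y \<in> X \<Longrightarrow> w b y = (\<Sum>a\<in>A. (\<Sum>x\<in>E. lam a x * w b x) * w a y)"
    by blast
  \<comment> \<open>The error of the old interpolation at \<open>w c\<close>. If it vanishes on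
    \<open>X\<close>, the weights of \<open>c\<close> can be 0; otherwise a point where it is
    nonzero is added.\<close>
  define g where "g y = w c y - (\<Sum>a\<in>A. (\<Sum>x\<in>E. lam a x * w c x) * w a y)" for y
  show ?case
  proof (cases "\<forall>y\<in>X. g y = 0")
    case True
    have *: "(\<Sum>a\<in>A. (\<Sum>x\<in>E. (if a = c then 0 else lam a x) * w b x) * w a y)
       = (\<Sum>a\<in>A. (\<Sum>x\<in>E. lam a x * w b x) * w a y)" for b y
      using insert.hyps by (intro sum.cong arg_cong2[of _ _ _ _ "(*)"]) auto
    have "w b y = (\<Sum>a\<in>insert c A. (\<Sum>x\<in>E. (if a = c then 0 else lam a x) * w b x) * w a y)"
      if "b \<in> insert c A" "y \<in> X" for b y
      using insert.hyps True that IH[of b y] unfolding g_def by (auto simp: *)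
    then show ?thesis using E by (intro exI[of _ E] exI[of _ "\<lambda>a x. if a = c then 0 else lam a x"]) blast
  next
    case False
    then obtain x0 where x0: "x0 \<in> X" "g x0 \<noteq> 0" by auto
    define E' where "E' = insert x0 E"
    define lam1 where "lam1 a x = (if x \<in> E then lam a x else 0)" for a x
    define Lam where "Lam a f = (\<Sum>x\<in>E'. lam1 a x * f x)" for a and f :: "'x \<Rightarrow> complex"
    have finE': "finite E'" using E by (simp add: E'_def)
    have Lam: "Lam a f = (\<Sum>x\<in>E. lam a x * f x)" for a f
      unfolding Lam_def using E
      by (subst sum.mono_neutral_right[of E' E]) (auto simp: E'_def lam1_def)
    \<comment> \<open>These weights represent a functional that kills \<open>w b\<close> for
      \<open>b\<close> in \<open>A\<close> and takes the value 1 at \<open>w c\<close>.\<close>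
    define m where "m x = ((if x = x0 then 1 else 0) - (\<Sum>a\<in>A. lam1 a x * w a x0)) / g x0" for x
    define M where "M f = (\<Sum>x\<in>E'. m x * f x)" for f
    have M: "M f = (f x0 - (\<Sum>a\<in>A. Lam a f * w a x0)) / g x0" for f
    proof -
      have "M f = (\<Sum>x\<in>E'. (if x = x0 then f x else 0) - (\<Sum>a\<in>A. lam1 a x * w a x0 * f x)) / g x0"
        unfolding M_def m_def sum_divide_distrib
        by (intro sum.cong) (auto simp: field_simps sum_distrib_left)
      also have "(\<Sum>x\<in>E'. (if x = x0 then f x else 0) - (\<Sum>a\<in>A. lam1 a x * w a x0 * f x))
         = f x0 - (\<Sum>x\<in>E'. \<Sum>a\<in>A. lam1 a x * w a x0 * f x)"
        using finE' by (simp add: sum_subtractf E'_def)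
      also have "(\<Sum>x\<in>E'. \<Sum>a\<in>A. lam1 a x * w a x0 * f x) = (\<Sum>a\<in>A. Lam a f * w a x0)"
        unfolding Lam_def sum_distrib_right
        by (subst sum.swap) (simp add: mult_ac)
      finally show ?thesis .
    qed
    have M0: "M (w b) = 0" if "b \<in> A" for b using IH[OF that x0(1)] by (simp add: M Lam)
    have M1: "M (w c) = 1" using x0(2) by (simp add: M Lam g_def)
    \<comment> \<open>Subtracting multiples of \<open>m\<close> cancels the other coefficients of
      \<open>w c\<close> and does not affect those of \<open>w b\<close> for \<open>b\<close> in
      \<open>A\<close>.\<close>
    define lam' where "lam' a x = (if a = c then m x else lam1 a x - Lam a (w c) * m x)" for a x
    have lam': "(\<Sum>x\<in>E'. lam' a x * f x) = (if a = c then M f else Lam a f - Lam a (w c) * M f)" for a f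
      by (simp add: lam'_def M_def Lam_def left_diff_distrib sum_subtractf sum_distrib_left mult.assoc)
    have "w b y = (\<Sum>a\<in>insert c A. (\<Sum>x\<in>E'. lam' a x * w b x) * w a y)"
      if "b \<in> insert c A" "y \<in> X" for b y
    proof -
      have "(\<Sum>a\<in>insert c A. (\<Sum>x\<in>E'. lam' a x * w b x) * w a y) =
         M (w b) * w c y + (\<Sum>a\<in>A. (Lam a (w b) - Lam a (w c) * M (w b)) * w a y)"
        unfolding lam' using insert.hyps by (auto intro!: sum.cong)
      also have "\<dots> = w b y"
      proof (cases "b = c")
        case True
        then show ?thesis by (simp add: M1)
      next
        case False
        with that have "b \<in> A" by simp
        then show ?thesis using IH[of b y] that(2) by (simp add: M0 Lam)
      qed
      finally show ?thesis ..
    qed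
    then show ?thesis
      using finE' E x0 by (intro exI[of _ E'] exI[of _ lam']) (auto simp: E'_def)
  qed
qed

section \<open>Compactness and the nearest point of the cone\<close>

lemma bounded_family_convergent_subseq:
  fixes f :: "nat \<Rightarrow> 'i \<Rightarrow> complex"
  assumes "finite I" "\<And>i n. i \<in> I \<Longrightarrow> cmod (f n i) \<le> B i"
  shows "\<exists>r l. strict_mono (r :: nat \<Rightarrow> nat) \<and> (\<forall>i\<in>I. (\<lambda>n. f (r n) i) \<longlonglongrightarrow> l i)"
  using assms
proof (induction I rule: finite_induct)
  case empty
  show ?case using strict_mono_id by (auto simp: id_def)
next
  case (insert j I)
  then obtain r :: "nat \<Rightarrow> nat" and l where r: "strict_mono r" "\<And>i. i \<in> I \<Longrightarrow> (\<lambda>n. f (r n) i) \<longlonglongrightarrow> l i"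
    by blast
  have "bounded (range (\<lambda>n. f (r n) j))"
    using insert.prems by (intro boundedI[of _ "B j"]) auto
  then obtain m and q :: "nat \<Rightarrow> nat" where q: "strict_mono q" "((\<lambda>n. f (r n) j) \<circ> q) \<longlonglongrightarrow> m"
    using bounded_imp_convergent_subsequence by blast
  have "(\<lambda>n. f (r (q n)) i) \<longlonglongrightarrow> (l(j := m)) i" if "i \<in> insert j I" for i
  proof (cases "i = j")
    case True
    then show ?thesis using q(2) by (simp add: o_def)
  next
    case False
    then show ?thesis using LIMSEQ_subseq_LIMSEQ[OF r(2) q(1), of i] that by (simp add: o_def)
  qed
  then show ?case using strict_mono_o[OF r(1) q(1)]
    by (intro exI[of _ "r \<circ> q"] exI[of _ "l(j := m)"]) (auto simp: o_def)
qed

lemma qform_tendsto: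
  assumes "\<And>a b. a \<in> A \<Longrightarrow> b \<in> A \<Longrightarrow> (\<lambda>n. Z n a b) \<longlonglongrightarrow> L a b"
  shows "(\<lambda>n. qform A (Z n) v) \<longlonglongrightarrow> qform A L v"
  unfolding qform_def using assms by (intro tendsto_intros) auto

lemma pos_form_limit:
  assumes "\<And>a b. a \<in> A \<Longrightarrow> b \<in> A \<Longrightarrow> (\<lambda>n. Z n a b) \<longlonglongrightarrow> L a b" "\<And>n. pos_form A (Z n)"
  shows "pos_form A L"
  unfolding pos_form_def
proof
  fix v
  have lim: "(\<lambda>n. qform A (Z n) v) \<longlonglongrightarrow> qform A L v" using assms(1) by (rule qform_tendsto)
  have pos: "0 \<le> qform A (Z n) v" for n using assms(2) by (simp add: pos_form_def)
  have "0 \<le> Re (qform A L v)"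
    using pos by (intro LIMSEQ_le_const[OF tendsto_Re[OF lim]]) (auto simp: less_eq_complex_def)
  moreover have "(\<lambda>n. Im (qform A (Z n) v)) = (\<lambda>n. 0)"
    using pos by (auto simp: less_eq_complex_def fun_eq_iff)
  with tendsto_Im[OF lim] have "Im (qform A L v) = 0" by (simp add: LIMSEQ_const_iff)
  ultimately show "0 \<le> qform A L v" by (simp add: less_eq_complex_def)
qed

text \<open>First-order optimality: divide by \<open>e\<close> and let \<open>e\<close> tend to 0.
  Testing only \<open>e \<le> 1\<close> leaves room for perturbations that scale a matrix by
  \<open>1 - e\<close>.\<close>

lemma nonpos_if_quadratic_nonneg:
  fixes b d :: real
  assumes "\<And>e. 0 < e \<Longrightarrow> e \<le> 1 \<Longrightarrow> 0 \<le> e\<^sup>2 * d - 2 * e * b"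
  shows "b \<le> 0"
proof (rule ccontr)
  assume b: "\<not> b \<le> 0"
  define e where "e = min 1 (b / (\<bar>d\<bar> + 1))"
  have "e \<le> b / (\<bar>d\<bar> + 1)" by (simp add: e_def)
  then have e: "e * (\<bar>d\<bar> + 1) \<le> b" "0 < e" "e \<le> 1"
    using b by (simp add: pos_le_divide_eq) (use b in \<open>auto simp: e_def\<close>)
  have "2 * b \<le> e * d"
    using assms[OF e(2,3)] e(2) by (simp add: power2_eq_square mult.assoc)
  also have "\<dots> \<le> e * (\<bar>d\<bar> + 1)" using e(2) by (intro mult_left_mono) auto
  finally show False using e(1) b by linarith
qed

text \<open>A minimising sequence of matrices may be unbounded, since the vectors
  \<open>w s _ x\<close> with \<open>x\<close> in \<open>E\<close> may fail to span. The Gram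
  kernels on the points of \<open>E\<close> are bounded, however, and their limits are carried back
  to matrices on \<open>A\<close> by interpolation.\<close>

lemma gram_minimizer:
  fixes w :: "'s \<Rightarrow> 'a \<Rightarrow> 'x \<Rightarrow> complex" and p :: "'x \<Rightarrow> real"
    and S :: "'s set" and A :: "'a set"
  defines "c \<equiv> \<lambda>Z x. Re (\<Sum>s\<in>S. qform A (Z s) (\<lambda>a. w s a x))"
  assumes fin: "finite S" "finite A" "finite E"
  shows "\<exists>Z. (\<forall>s\<in>S. pos_form A (Z s)) \<and>
           (\<forall>Y. (\<forall>s\<in>S. pos_form A (Y s)) \<longrightarrow> (\<Sum>x\<in>E. (p x - c Z x)\<^sup>2) \<le> (\<Sum>x\<in>E. (p x - c Y x)\<^sup>2))"
proof -
  define F where "F Z = (\<Sum>x\<in>E. (p x - c Z x)\<^sup>2)" for Z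
  define D where "D = {Z. \<forall>s\<in>S. pos_form A (Z s)}"
  have "(\<lambda>_ _ _. 0) \<in> D" by (simp add: D_def pos_form_def qform_def)
  then have ne: "F ` D \<noteq> {}" by blast
  have bdd: "bdd_below (F ` D)" by (rule bdd_belowI[of _ 0]) (auto simp: F_def sum_nonneg)
  define i where "i = Inf (F ` D)"
  have "\<exists>Z\<in>D. F Z < i + 1 / (real n + 1)" for n :: nat
    using cInf_lessD[OF ne, of "i + 1 / (real n + 1)"] by (auto simp: i_def)
  then obtain Z where Z: "\<And>n. Z n \<in> D" "\<And>n. F (Z n) < i + 1 / (real n + 1)" by metis
  have Zpos: "pos_form A (Z n s)" if "s \<in> S" for n s using Z(1)[of n] that by (auto simp: D_def)
  define K where "K n s x y = (\<Sum>a\<in>A. \<Sum>b\<in>A. cnj (w s a x) * Z n s a b * w s b y)" for n s x y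
  have Kpos: "pos_form B (K n s)" if "s \<in> S" for B n s
    unfolding K_def using Zpos[OF that] by (rule pos_form_congruence)
  have Kdiag: "K n s x x = qform A (Z n s) (\<lambda>a. w s a x)" for n s x
    by (simp add: K_def qform_def)
  \<comment> \<open>As \<open>F (Z n) \<le> i + 1\<close>, each \<open>c (Z n) x\<close> lies within
    \<open>sqrt (i + 1)\<close> of \<open>p x\<close>. Its summands \<open>Re (K n s x x)\<close>
    are nonnegative and obey the same upper bound.\<close>
  define b where "b x = \<bar>p x\<bar> + sqrt (i + 1)" for x
  have Kb: "Re (K n s x x) \<le> b x" if "s \<in> S" "x \<in> E" for n s x
  proof -
    have "(p x - c (Z n) x)\<^sup>2 \<le> F (Z n)"
      unfolding F_def using that fin by (intro member_le_sum) auto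
    also have "\<dots> \<le> i + 1" using Z(2)[of n] by (rule order.strict_implies_order[OF less_le_trans]) auto
    finally have "\<bar>p x - c (Z n) x\<bar> \<le> sqrt (i + 1)" by (metis real_sqrt_abs real_sqrt_le_mono)
    then have "c (Z n) x \<le> b x" unfolding b_def by linarith
    moreover have "Re (K n s x x) \<le> (\<Sum>s\<in>S. Re (K n s x x))"
      using that fin pos_form_diag[OF Kpos fin(3) that(2)]
      by (intro member_le_sum) (auto simp: less_eq_complex_def)
    ultimately show ?thesis by (simp add: c_def Kdiag)
  qed
  have "\<exists>r l. strict_mono (r :: nat \<Rightarrow> nat) \<and>
      (\<forall>(s, x, y)\<in>S \<times> E \<times> E. (\<lambda>n. K (r n) s x y) \<longlonglongrightarrow> l s x y)"
  proof -
    have "cmod (case q of (s, x, y) \<Rightarrow> K n s x y) \<le> (case q of (s, x, y) \<Rightarrow> b x + b y)"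
      if "q \<in> S \<times> E \<times> E" for q n
    proof -
      obtain s x y where q: "q = (s, x, y)" "s \<in> S" "x \<in> E" "y \<in> E" using \<open>q \<in> _\<close> by auto
      have "cmod (K n s x y) \<le> Re (K n s x x) + Re (K n s y y)"
        using pos_form_bound[OF Kpos fin(3)] q by blast
      also have "\<dots> \<le> b x + b y" using Kb q by (intro add_mono) auto
      finally show ?thesis by (simp add: q)
    qed
    from bounded_family_convergent_subseq[of "S \<times> E \<times> E" "\<lambda>n q. case q of (s, x, y) \<Rightarrow> K n s x y", OF _ this] fin
    obtain r l where r: "strict_mono (r :: nat \<Rightarrow> nat)"
      "\<forall>q\<in>S \<times> E \<times> E. (\<lambda>n. case q of (s, x, y) \<Rightarrow> K (r n) s x y) \<longlonglongrightarrow> l q"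
      by blast
    then show ?thesis
      by (intro exI[of _ r] exI[of _ "\<lambda>s x y. l (s, x, y)"]) auto
  qed
  then obtain r l where r: "strict_mono (r :: nat \<Rightarrow> nat)"
    and l: "\<And>s x y. s \<in> S \<Longrightarrow> x \<in> E \<Longrightarrow> y \<in> E \<Longrightarrow> (\<lambda>n. K (r n) s x y) \<longlonglongrightarrow> l s x y"
    by fastforce
  have "\<forall>s. \<exists>G lam. finite G \<and> G \<subseteq> E \<and>
      (\<forall>b\<in>A. \<forall>y\<in>E. w s b y = (\<Sum>a\<in>A. (\<Sum>x\<in>G. lam a x * w s b x) * w s a y))"
    by (intro allI finite_family_interpolation[OF fin(2)])
  then have "\<exists>G lam. \<forall>s. finite (G s) \<and> G s \<subseteq> E \<and>
      (\<forall>b\<in>A. \<forall>y\<in>E. w s b y = (\<Sum>a\<in>A. (\<Sum>x\<in>G s. lam s a x * w s b x) * w s a y))"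
    by (simp only: choice_iff)
  then obtain G lam where G: "\<And>s. finite (G s)" "\<And>s. G s \<subseteq> E"
    and lam: "\<And>s b y. b \<in> A \<Longrightarrow> y \<in> E \<Longrightarrow> w s b y = (\<Sum>a\<in>A. (\<Sum>x\<in>G s. lam s a x * w s b x) * w s a y)"
    by blast
  \<comment> \<open>Pulled back by the interpolation weights, these matrices depend linearly on
    finitely many entries of the kernels and so converge along the subsequence.\<close>
  define Y where "Y n s a b = (\<Sum>x\<in>G s. \<Sum>y\<in>G s. cnj (lam s a x) * K n s x y * lam s b y)" for n s a b
  define Y' where "Y' s a b = (\<Sum>x\<in>G s. \<Sum>y\<in>G s. cnj (lam s a x) * l s x y * lam s b y)" for s a b
  have Ylim: "(\<lambda>n. Y (r n) s a b) \<longlonglongrightarrow> Y' s a b" if "s \<in> S" for s a b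
    unfolding Y_def Y'_def using G that by (intro tendsto_intros l) auto
  have Ypos: "pos_form A (Y n s)" if "s \<in> S" for n s
    unfolding Y_def using Kpos[OF that] by (rule pos_form_congruence)
  have Y'D: "Y' \<in> D"
    unfolding D_def
  proof (intro CollectI ballI)
    fix s assume s: "s \<in> S"
    show "pos_form A (Y' s)"
      by (rule pos_form_limit[of A "\<lambda>n. Y (r n) s", OF Ylim[OF s] Ypos[OF s]])
  qed
  \<comment> \<open>The weights reproduce every \<open>w s a\<close> on \<open>E\<close>, so passing
    to the kernel and back does not change the values there.\<close>
  have YZ: "qform A (Y n s) (\<lambda>a. w s a y) = qform A (Z n s) (\<lambda>a. w s a y)" if "y \<in> E" for n s y
  proof -
    have "qform A (Y n s) (\<lambda>a. w s a y) =
        qform A (Z n s) (\<lambda>a. \<Sum>x\<in>G s. w s a x * (\<Sum>b\<in>A. lam s b x * w s b y))"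
      unfolding Y_def qform_congruence unfolding K_def qform_congruence ..
    also have "(\<Sum>x\<in>G s. w s a x * (\<Sum>b\<in>A. lam s b x * w s b y)) = w s a y" if "a \<in> A" for a
    proof -
      have "(\<Sum>x\<in>G s. w s a x * (\<Sum>b\<in>A. lam s b x * w s b y)) =
          (\<Sum>b\<in>A. (\<Sum>x\<in>G s. lam s b x * w s a x) * w s b y)"
        by (simp add: sum_distrib_left sum_distrib_right mult_ac sum.swap[of _ "G s"])
      also have "\<dots> = w s a y" using lam[OF that \<open>y \<in> E\<close>, of s] by simp
      finally show ?thesis .
    qed
    then have "qform A (Z n s) (\<lambda>a. \<Sum>x\<in>G s. w s a x * (\<Sum>b\<in>A. lam s b x * w s b y))
       = qform A (Z n s) (\<lambda>a. w s a y)"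
      unfolding qform_def by (intro sum.cong) auto
    finally show ?thesis .
  qed
  have "(\<lambda>n. c (Z (r n)) y) \<longlonglongrightarrow> c Y' y" if "y \<in> E" for y
    unfolding c_def using that
    by (simp only: YZ[symmetric]) (intro tendsto_intros qform_tendsto Ylim)
  then have "(\<lambda>n. F (Z (r n))) \<longlonglongrightarrow> F Y'"
    unfolding F_def by (intro tendsto_intros) auto
  moreover have "(\<lambda>n. i + 1 / (real (r n) + 1)) \<longlonglongrightarrow> i"
  proof -
    have "(\<lambda>n. i + 1 / (real n + 1)) \<longlonglongrightarrow> i + 0"
      using LIMSEQ_inverse_real_of_nat by (intro tendsto_intros) (simp add: inverse_eq_divide add.commute)
    from LIMSEQ_subseq_LIMSEQ[OF this r] show ?thesis by (simp add: o_def)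
  qed
  ultimately have "F Y' \<le> i"
    using Z(2) by (intro LIMSEQ_le) (auto intro!: exI[of _ 0] less_imp_le)
  moreover have "i \<le> F V" if "V \<in> D" for V
    unfolding i_def using that bdd by (intro cInf_lower) auto
  ultimately show ?thesis using Y'D unfolding D_def F_def
    by (intro exI[of _ Y']) (auto intro: order_trans)
qed

text \<open>Projection onto a closed convex cone: at the nearest point the residual \<open>r\<close>
  is orthogonal to that point and nonpositive on the cone. Thus \<open>dual\<close> applies to
  \<open>- r\<close> and makes the pairing of \<open>r\<close> with \<open>p\<close> nonpositive;
  but this pairing is the squared norm of \<open>r\<close>.\<close>

lemma gram_cone_duality:
  fixes w :: "'s \<Rightarrow> 'a \<Rightarrow> 'x \<Rightarrow> complex" and p :: "'x \<Rightarrow> real"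
  assumes fin: "finite S" "finite A" "finite E"
    and dual: "\<And>r :: 'x \<Rightarrow> real.
      (\<And>s v. s \<in> S \<Longrightarrow> 0 \<le> (\<Sum>x\<in>E. r x * (cmod (\<Sum>a\<in>A. v a * w s a x))\<^sup>2)) \<Longrightarrow> 0 \<le> (\<Sum>x\<in>E. r x * p x)"
  shows "\<exists>Z. (\<forall>s\<in>S. pos_form A (Z s)) \<and>
           (\<forall>x\<in>E. of_real (p x) = (\<Sum>s\<in>S. qform A (Z s) (\<lambda>a. w s a x)))"
proof -
  define c where "c Z x = Re (\<Sum>s\<in>S. qform A (Z s) (\<lambda>a. w s a x))" for Z x
  obtain Z where Z: "\<And>s. s \<in> S \<Longrightarrow> pos_form A (Z s)"
    and min: "\<And>Y. (\<And>s. s \<in> S \<Longrightarrow> pos_form A (Y s)) \<Longrightarrow> (\<Sum>x\<in>E. (p x - c Z x)\<^sup>2) \<le> (\<Sum>x\<in>E. (p x - c Y x)\<^sup>2)"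
    using gram_minimizer[OF fin, of p w] unfolding c_def by blast
  define r where "r x = p x - c Z x" for x
  \<comment> \<open>The variational inequality, for any direction \<open>h\<close> in which the cone
    contains the points \<open>c Z + e * h\<close> with \<open>0 < e \<le> 1\<close>.\<close>
  have var: "(\<Sum>x\<in>E. r x * h x) \<le> 0"
    if "\<And>e. 0 < e \<Longrightarrow> e \<le> 1 \<Longrightarrow> \<exists>Y. (\<forall>s\<in>S. pos_form A (Y s)) \<and> (\<forall>x\<in>E. c Y x = c Z x + e * h x)" for h
  proof (rule nonpos_if_quadratic_nonneg)
    fix e :: real assume "0 < e" "e \<le> 1"
    with that obtain Y where Y: "\<forall>s\<in>S. pos_form A (Y s)" "\<forall>x\<in>E. c Y x = c Z x + e * h x" by blast
    have "(\<Sum>x\<in>E. (r x)\<^sup>2) \<le> (\<Sum>x\<in>E. (p x - c Y x)\<^sup>2)" using min Y(1) by (simp add: r_def)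
    also have "\<dots> = (\<Sum>x\<in>E. (r x)\<^sup>2 + e\<^sup>2 * (h x)\<^sup>2 - 2 * e * (r x * h x))"
      using Y(2) by (intro sum.cong) (auto simp: r_def power2_eq_square algebra_simps)
    also have "\<dots> = (\<Sum>x\<in>E. (r x)\<^sup>2) + e\<^sup>2 * (\<Sum>x\<in>E. (h x)\<^sup>2) - 2 * e * (\<Sum>x\<in>E. r x * h x)"
      by (simp add: sum.distrib sum_subtractf sum_distrib_left)
    finally show "0 \<le> e\<^sup>2 * (\<Sum>x\<in>E. (h x)\<^sup>2) - 2 * e * (\<Sum>x\<in>E. r x * h x)" by linarith
  qed
  have rc: "(\<Sum>x\<in>E. r x * c Z x) = 0"
  proof -
    have scale: "qform A (\<lambda>a b. of_real k * Z s a b) v = of_real k * qform A (Z s) v" for k s v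
      by (simp add: qform_def sum_distrib_left mult_ac)
    have pos: "pos_form A (\<lambda>a b. of_real k * Z s a b)" if "s \<in> S" "0 \<le> k" for k s
      using Z[OF that(1)] that(2) by (auto simp: pos_form_def scale less_eq_complex_def)
    have sc: "c (\<lambda>s a b. of_real k * Z s a b) x = k * c Z x" for k x
      by (simp add: c_def scale sum_distrib_left)
    \<comment> \<open>Scaling \<open>Z\<close> by \<open>1 + k\<close> stays in the cone for
      \<open>k \<ge> -1\<close>, so the directions \<open>c Z\<close> and \<open>- c Z\<close> are
      both admissible.\<close>
    have Y: "\<exists>Y. (\<forall>s\<in>S. pos_form A (Y s)) \<and> (\<forall>x\<in>E. c Y x = c Z x + k * c Z x)" if "-1 \<le> k" for k
      using pos[of _ "1 + k"] sc[of "1 + k"] that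
      by (intro exI[of _ "\<lambda>s a b. of_real (1 + k) * Z s a b"]) (auto simp: distrib_right simp del: of_real_add)
    have "(\<Sum>x\<in>E. r x * c Z x) \<le> 0" using Y by (intro var) auto
    moreover have "(\<Sum>x\<in>E. r x * - c Z x) \<le> 0"
      using Y[of "- _"] by (intro var) auto
    ultimately show ?thesis by (simp add: sum_negf)
  qed
  have "0 \<le> (\<Sum>x\<in>E. - r x * (cmod (\<Sum>a\<in>A. v a * w s a x))\<^sup>2)" if s: "s \<in> S" for s v
  proof -
    have "(\<Sum>x\<in>E. r x * (cmod (\<Sum>a\<in>A. v a * w s a x))\<^sup>2) \<le> 0"
    proof (rule var)
      fix e :: real assume e: "0 < e" "e \<le> 1"
      \<comment> \<open>A rank-one term added to the component \<open>s\<close> alone moves the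
        minimiser in the direction of one squared modulus.\<close>
      define Y where "Y s' a b = Z s' a b + (if s' = s then of_real e * (cnj (v a) * v b) else 0)" for s' a b
      have rk: "qform A (\<lambda>a b. cnj (v a) * v b) u = of_real ((cmod (\<Sum>a\<in>A. v a * u a))\<^sup>2)" for u
        using qform_rank_one_sum[of A "\<lambda>a b. cnj (v a) * v b" "\<lambda>_ a. cnj (v a)" "{()}" u] by simp
      have Y: "qform A (Y s') u = qform A (Z s') u +
          (if s' = s then of_real e * of_real ((cmod (\<Sum>a\<in>A. v a * u a))\<^sup>2) else 0)" for s' u
        unfolding rk[symmetric]
        by (simp add: Y_def qform_def algebra_simps sum.distrib sum_distrib_left)
      have "\<forall>s\<in>S. pos_form A (Y s)"
        using Z e by (auto simp: pos_form_def Y less_eq_complex_def)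
      moreover have "c Y x = c Z x + e * (cmod (\<Sum>a\<in>A. v a * w s a x))\<^sup>2" for x
        using s fin by (simp add: c_def Y sum.distrib flip: of_real_mult of_real_power)
      ultimately show "\<exists>Y. (\<forall>s\<in>S. pos_form A (Y s)) \<and>
          (\<forall>x\<in>E. c Y x = c Z x + e * (cmod (\<Sum>a\<in>A. v a * w s a x))\<^sup>2)" by blast
    qed
    then show ?thesis by (simp add: sum_negf)
  qed
  from dual[of "\<lambda>x. - r x", OF this] have "(\<Sum>x\<in>E. r x * p x) \<le> 0" by (simp add: sum_negf)
  moreover have "(\<Sum>x\<in>E. r x * p x) = (\<Sum>x\<in>E. (r x)\<^sup>2) + (\<Sum>x\<in>E. r x * c Z x)"
    by (simp add: r_def power2_eq_square algebra_simps flip: sum.distrib)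
  ultimately have "(\<Sum>x\<in>E. (r x)\<^sup>2) = 0" using rc sum_nonneg[of E "\<lambda>x. (r x)\<^sup>2"] by simp
  then have r0: "r x = 0" if "x \<in> E" for x using that fin by (simp add: sum_nonneg_eq_0_iff)
  have "of_real (p x) = (\<Sum>s\<in>S. qform A (Z s) (\<lambda>a. w s a x))" if "x \<in> E" for x
  proof -
    have "Im (\<Sum>s\<in>S. qform A (Z s) (\<lambda>a. w s a x)) = 0"
      using Z by (simp add: pos_form_def less_eq_complex_def)
    then show ?thesis using r0[OF that] by (simp add: r_def c_def complex_eq_iff)
  qed
  then show ?thesis using Z by blast
qed

section \<open>Polynomials in complex variables and their conjugates\<close>

lemma infinite_unit_circle: "infinite {z :: complex. cmod z = 1}"
proof
  assume fin: "finite {z :: complex. cmod z = 1}"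
  have "inj_on cis {0..1}"
  proof (rule inj_onI)
    fix x y :: real assume *: "x \<in> {0..1}" "y \<in> {0..1}" "cis x = cis y"
    then have "cos x = cos y" by (metis cis.sel(1))
    then show "x = y" using * pi_gt3 by (subst (asm) cos_inj_pi[symmetric]) (auto simp: cos_inj_pi)
  qed
  moreover have "cis ` {0..1} \<subseteq> {z. cmod z = 1}" by auto
  ultimately have "finite {0..1::real}" using fin finite_imageD finite_subset by blast
  then show False using infinite_Icc[of "0::real" 1] by simp
qed

text \<open>A polynomial with infinitely many roots is 0. As \<open>e\<close> may repeat values, its
  coefficients are the sums of \<open>c\<close> over the fibres of \<open>e\<close>.\<close>

lemma power_sum_coeff_eq_0:
  fixes c :: "'i \<Rightarrow> complex"
  assumes "finite S" "infinite U" "\<And>z. z \<in> U \<Longrightarrow> (\<Sum>i\<in>S. c i * z ^ e i) = 0"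
  shows "(\<Sum>i | i \<in> S \<and> e i = k. c i) = 0"
proof -
  define P where "P = (\<Sum>i\<in>S. monom (c i) (e i))"
  have "U \<subseteq> {z. poly P z = 0}" using assms(3) by (auto simp: P_def poly_sum poly_monom)
  then have "P = 0" using assms(2) poly_roots_finite finite_subset by blast
  then have "coeff P k = 0" by simp
  then show ?thesis using assms(1)
    by (simp add: P_def coeff_sum sum.inter_filter[symmetric])
qed

text \<open>Real scaling of \<open>z\<close> isolates the terms of one total degree; phases then
  separate these from each other.\<close>

lemma conj_power_sum_coeff_eq_0:
  fixes c :: "'i \<Rightarrow> complex"
  assumes fin: "finite S" and zero: "\<And>z. (\<Sum>i\<in>S. c i * (z ^ al i * cnj z ^ be i)) = 0"
  shows "(\<Sum>i | i \<in> S \<and> al i = A \<and> be i = B. c i) = 0"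
proof -
  define S' where "S' = {i \<in> S. al i + be i = A + B}"
  have phase: "(\<Sum>i\<in>S'. c i * (u ^ al i * cnj u ^ be i)) = 0" if "cmod u = 1" for u
    unfolding S'_def
  proof (rule power_sum_coeff_eq_0[OF fin, where U = "range complex_of_real"])
    show "infinite (range complex_of_real)"
      by (simp add: finite_image_iff inj_on_def infinite_UNIV_char_0)
    fix z assume "z \<in> range complex_of_real"
    then have z: "cnj z = z" by auto
    show "(\<Sum>i\<in>S. c i * (u ^ al i * cnj u ^ be i) * z ^ (al i + be i)) = 0"
      using zero[of "z * u"] by (simp add: z power_mult_distrib power_add mult_ac)
  qed
  have "(\<Sum>i | i \<in> S' \<and> 2 * al i = 2 * A. c i) = 0"
  proof (rule power_sum_coeff_eq_0[OF _ infinite_unit_circle])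
    show "finite S'" using fin by (simp add: S'_def)
    fix u :: complex assume "u \<in> {z. cmod z = 1}"
    then have u: "cmod u = 1" by simp
    then have uu: "u * cnj u = 1" by (simp add: complex_norm_square[symmetric])
    \<comment> \<open>On the unit circle, multiplication by \<open>u ^ (A + B)\<close> clears the
      conjugates and leaves the exponent \<open>2 * al i\<close>.\<close>
    have "u ^ (2 * al i) = u ^ (A + B) * (u ^ al i * cnj u ^ be i)" if "i \<in> S'" for i
    proof -
      have "A + B = al i + be i" using that by (simp add: S'_def)
      then have "u ^ (A + B) * (u ^ al i * cnj u ^ be i) = u ^ (2 * al i) * (u * cnj u) ^ be i"
        by (simp add: power_add power_mult_distrib mult_2 mult.assoc mult.left_commute)
      then show ?thesis by (simp add: uu)
    qed
    then have "(\<Sum>i\<in>S'. c i * u ^ (2 * al i)) = u ^ (A + B) * (\<Sum>i\<in>S'. c i * (u ^ al i * cnj u ^ be i))"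
      by (simp add: sum_distrib_left mult_ac)
    then show "(\<Sum>i\<in>S'. c i * u ^ (2 * al i)) = 0" using phase[OF u] by simp
  qed
  also have "{i \<in> S'. 2 * al i = 2 * A} = {i \<in> S. al i = A \<and> be i = B}" by (auto simp: S'_def)
  finally show ?thesis by simp
qed

text \<open>One variable is separated at a time; the monomials in the others are absorbed into the
  coefficients.\<close>

lemma conj_monomial_sum_coeff_eq_0:
  fixes c :: "'i \<Rightarrow> complex" and al be :: "'i \<Rightarrow> 'v \<Rightarrow> nat"
  assumes "finite V" "finite S"
    and "\<And>x. (\<Sum>i\<in>S. c i * (\<Prod>v\<in>V. x v ^ al i v * cnj (x v) ^ be i v)) = 0"
  shows "(\<Sum>i | i \<in> S \<and> (\<forall>v\<in>V. al i v = A v \<and> be i v = B v). c i) = 0"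
  using assms
proof (induction V arbitrary: S rule: finite_induct)
  case empty
  then show ?case by simp
next
  case (insert v V)
  define S' where "S' = {i \<in> S. al i v = A v \<and> be i v = B v}"
  have "(\<Sum>i | i \<in> S' \<and> (\<forall>v\<in>V. al i v = A v \<and> be i v = B v). c i) = 0"
  proof (rule insert.IH)
    show "finite S'" using insert.prems by (simp add: S'_def)
    fix x :: "'v \<Rightarrow> complex"
    show "(\<Sum>i\<in>S'. c i * (\<Prod>v\<in>V. x v ^ al i v * cnj (x v) ^ be i v)) = 0"
      unfolding S'_def
    proof (rule conj_power_sum_coeff_eq_0[OF insert.prems(1)])
      fix z :: complex
      have "(\<Prod>u\<in>V. (x(v := z)) u ^ al i u * cnj ((x(v := z)) u) ^ be i u) =
            (\<Prod>u\<in>V. x u ^ al i u * cnj (x u) ^ be i u)" for i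
        using insert.hyps by (intro prod.cong) auto
      then show "(\<Sum>i\<in>S. c i * (\<Prod>v\<in>V. x v ^ al i v * cnj (x v) ^ be i v) * (z ^ al i v * cnj z ^ be i v)) = 0"
        using insert.prems(2)[of "x(v := z)"] insert.hyps by (simp add: mult_ac)
    qed
  qed
  also have "{i \<in> S'. \<forall>v\<in>V. al i v = A v \<and> be i v = B v} =
      {i \<in> S. \<forall>v\<in>insert v V. al i v = A v \<and> be i v = B v}" by (auto simp: S'_def)
  finally show ?case .
qed

section \<open>Monomials of index tuples and orthogonality to Bose symmetric matrices\<close>

definition mon :: "'n list \<Rightarrow> ('n \<Rightarrow> complex) \<Rightarrow> complex" where
  "mon a x = prod_list (map x a)"

lemma mon_simps [simp]:
  "mon [] x = 1" "mon (i # a) x = x i * mon a x" "mon (a @ b) x = mon a x * mon b x"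
  by (simp_all add: mon_def)

lemma mon_eq_prod_count: "mon a x = (\<Prod>i\<in>(UNIV :: 'n::finite set). x i ^ count_list a i)"
proof (induction a)
  case (Cons j a)
  have "(\<Prod>i\<in>UNIV. x i ^ count_list (j # a) i) = (\<Prod>i\<in>UNIV. (if i = j then x i else 1) * x i ^ count_list a i)"
    by (intro prod.cong) auto
  then show ?case using Cons by (simp add: prod.distrib)
qed simp

lemma mon_cong_mset: "mset a = mset b \<Longrightarrow> mon a x = mon b x"
  unfolding mon_def by (metis mset_map prod_mset_prod_list)

lemma finite_tuples [simp]: "finite (tuples k :: 'n::finite list set)"
  unfolding tuples_def using finite_lists_length_eq[of "UNIV :: 'n set" k] by simp

text \<open>Column permutations act trivially by definition, and Hermitian symmetry transfers this
  to rows.\<close>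

lemma BS_cong_mset:
  fixes \<rho> :: "('n::finite, complex) tmat"
  assumes "\<rho> \<in> BS k" "a \<in> tuples k" "b \<in> tuples k" "mset a = mset a'" "mset b = mset b'"
  shows "\<rho> a b = \<rho> a' b'"
proof -
  have col: "\<rho> c d = \<rho> c d'" if "c \<in> tuples k" "d \<in> tuples k" "mset d = mset d'" for c d d'
  proof -
    from that(3) obtain \<sigma> where "\<sigma> permutes {..<length d}" "permute_list \<sigma> d = d'"
      using mset_eq_permutation[of d' d] by metis
    then show ?thesis using assms(1) that by (auto simp: BS_def tuples_def)
  qed
  have H: "\<rho> c d = cnj (\<rho> d c)" if "c \<in> tuples k" "d \<in> tuples k" for c d
    using assms(1) that unfolding BS_def Herm_def by blast
  have t: "a' \<in> tuples k" "b' \<in> tuples k"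
    using assms by (auto simp: tuples_def dest: mset_eq_length)
  have "\<rho> a b = \<rho> a b'" using col assms by blast
  also have "\<dots> = cnj (\<rho> b' a)" using H t assms by blast
  also have "\<dots> = cnj (\<rho> b' a')" using col[of b' a a'] t assms by simp
  also have "\<dots> = \<rho> a' b'" using H[OF t] by (rule sym)
  finally show ?thesis .
qed

text \<open>The coefficients of the form are the sums of entries of \<open>B\<close> over pairs of
  tuples with given multisets. A Bose symmetric matrix is constant on each such class, so its
  pairing with \<open>B\<close> is a combination of these vanishing sums.\<close>

lemma BS_perp_if_form_eq_0:
  fixes B :: "('n::finite, complex) tmat"
  assumes "B \<in> Herm k" and zero: "\<And>x. qform (tuples k) B (\<lambda>a. mon a x) = 0"
  shows "B \<in> BS_perp k"
proof -
  define S where "S = (tuples k \<times> tuples k :: ('n list \<times> 'n list) set)"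
  define c where "c = (\<lambda>(a, b). cnj (B a b))"
  define g where "g = (\<lambda>(a, b). (mset a, mset b) :: 'n multiset \<times> 'n multiset)"
  have fin: "finite S" by (simp add: S_def)
  have cl: "(\<Sum>q | q \<in> S \<and> g q = g q0. c q) = 0" for q0
  proof -
    have "(\<Sum>q\<in>S. c q * (\<Prod>v\<in>UNIV. x v ^ count_list (fst q) v * cnj (x v) ^ count_list (snd q) v)) = 0" for x
    proof -
      have "(\<Sum>q\<in>S. c q * (\<Prod>v\<in>UNIV. x v ^ count_list (fst q) v * cnj (x v) ^ count_list (snd q) v))
          = cnj (qform (tuples k) B (\<lambda>a. mon a x))"
        by (simp add: S_def c_def qform_def sum.cartesian_product' mon_eq_prod_count prod.distrib
            case_prod_beta mult_ac)
      then show ?thesis using zero by simp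
    qed
    from conj_monomial_sum_coeff_eq_0[OF finite fin this,
        of "count_list (fst q0)" "count_list (snd q0)"]
    have "(\<Sum>q | q \<in> S \<and> (\<forall>v. count_list (fst q) v = count_list (fst q0) v \<and>
        count_list (snd q) v = count_list (snd q0) v). c q) = 0" by simp
    also have "{q \<in> S. \<forall>v. count_list (fst q) v = count_list (fst q0) v \<and>
        count_list (snd q) v = count_list (snd q0) v} = {q \<in> S. g q = g q0}"
      by (auto simp: g_def multiset_eq_iff case_prod_beta count_mset)
    finally show ?thesis .
  qed
  have "hs_inner k B \<rho> = 0" if "\<rho> \<in> BS k" for \<rho>
  proof -
    have "hs_inner k B \<rho> = (\<Sum>q\<in>S. c q * \<rho> (fst q) (snd q))"
      by (simp add: hs_inner_def S_def c_def sum.cartesian_product' case_prod_beta)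
    also have "\<dots> = (\<Sum>y\<in>g ` S. \<Sum>q | q \<in> S \<and> g q = y. c q * \<rho> (fst q) (snd q))"
      using fin by (rule sum.image_gen)
    also have "\<dots> = 0"
    proof (rule sum.neutral, rule ballI)
      fix y assume "y \<in> g ` S"
      then obtain a0 b0 where y: "y = g (a0, b0)" by auto
      have "(\<Sum>q | q \<in> S \<and> g q = g (a0, b0). c q * \<rho> (fst q) (snd q)) =
          (\<Sum>q | q \<in> S \<and> g q = g (a0, b0). c q * \<rho> a0 b0)"
      proof (rule sum.cong, simp)
        fix q assume "q \<in> {q \<in> S. g q = g (a0, b0)}"
        then have "\<rho> (fst q) (snd q) = \<rho> a0 b0"
          by (intro BS_cong_mset[OF that]) (auto simp: S_def g_def case_prod_beta)
        then show "c q * \<rho> (fst q) (snd q) = c q * \<rho> a0 b0" by simp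
      qed
      also have "\<dots> = 0" by (simp add: cl flip: sum_distrib_right)
      finally show "(\<Sum>q | q \<in> S \<and> g q = y. c q * \<rho> (fst q) (snd q)) = 0" unfolding y .
    qed
    finally show ?thesis .
  qed
  then show ?thesis using assms(1) by (simp add: BS_perp_def)
qed

section \<open>Tensor powers and partial transposes\<close>

text \<open>Partial transposition reads its argument at row \<open>conj_swap s a b\<close> and
  column \<open>conj_swap s b a\<close>. For \<open>s \<le> t\<close> this is an involution on pairs
  of tuples, by which double sums are reindexed.\<close>

definition conj_swap :: "nat \<Rightarrow> 'n list \<Rightarrow> 'n list \<Rightarrow> 'n list" where
  "conj_swap s a b = take 1 a @ take s (drop 1 b) @ drop (1 + s) a"

text \<open>The vector with entries \<open>wmon s a x\<close> is \<open>x \<otimes> cnj x\<^sup>\<otimes>\<^sup>s \<otimes> x\<^sup>\<otimes>\<^sup>(\<^sup>t\<^sup>-\<^sup>s\<^sup>)\<close>; these are the vectors for which the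
  form of \<open>ptranspose t s X\<close> agrees with the form of \<open>X\<close> at \<open>x\<^sup>\<otimes>\<^sup>(\<^sup>t\<^sup>+\<^sup>1\<^sup>)\<close>.\<close>

definition wmon :: "nat \<Rightarrow> 'n list \<Rightarrow> ('n \<Rightarrow> complex) \<Rightarrow> complex" where
  "wmon s a x = mon (take 1 a) x * cnj (mon (take s (drop 1 a)) x) * mon (drop (1 + s) a) x"

lemma conj_swap_tuples:
  assumes "a \<in> tuples (t + 1)" "b \<in> tuples (t + 1)" "s \<le> t"
  shows "conj_swap s a b \<in> tuples (t + 1)"
  using assms by (auto simp: conj_swap_def tuples_def)

lemma conj_swap_conj_swap:
  assumes "a \<in> tuples (t + 1)" "b \<in> tuples (t + 1)" "s \<le> t"
  shows "conj_swap s (conj_swap s a b) (conj_swap s b a) = a"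
proof -
  have split: "c = take 1 c @ take s (drop 1 c) @ drop (1 + s) c" for c :: "'a list"
    by (metis append_take_drop_id drop_drop add.commute)
  have len: "length (take 1 c) = 1" "length (take s (drop 1 c)) = s" if "c \<in> tuples (t + 1)" for c :: "'a list"
    using that assms(3) by (auto simp: tuples_def)
  have *: "take 1 (p @ q @ r) = p" "take s (drop 1 (p @ q @ r)) = q" "drop (1 + s) (p @ q @ r) = r"
    if "length p = 1" "length q = s" for p q r :: "'a list"
    using that by auto
  show ?thesis
    unfolding conj_swap_def
    by (subst split[of a], unfold *[OF len(1)[OF assms(1)] len(2)[OF assms(2)]]
          *[OF len(1)[OF assms(2)] len(2)[OF assms(1)]]) simp
qed

lemma sum_conj_swap:
  fixes f :: "'n::finite list \<Rightarrow> 'n list \<Rightarrow> complex"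
  assumes "s \<le> t"
  shows "(\<Sum>a\<in>tuples (t + 1). \<Sum>b\<in>tuples (t + 1). f (conj_swap s a b) (conj_swap s b a)) =
         (\<Sum>a\<in>tuples (t + 1). \<Sum>b\<in>tuples (t + 1). f a b)"
  unfolding sum.cartesian_product
  by (rule sum.reindex_bij_witness[where i = "\<lambda>(a, b). (conj_swap s a b, conj_swap s b a)"
        and j = "\<lambda>(a, b). (conj_swap s a b, conj_swap s b a)"])
     (auto simp: conj_swap_conj_swap[OF _ _ assms] conj_swap_tuples[OF _ _ assms, simplified])

lemma ptranspose_apply:
  "a \<in> tuples (t + 1) \<Longrightarrow> b \<in> tuples (t + 1) \<Longrightarrow>
   ptranspose t s X a b = X (conj_swap s a b) (conj_swap s b a)"
  by (simp add: ptranspose_def conj_swap_def)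

lemma HermD:
  assumes "X \<in> Herm k"
  shows "X a b = cnj (X b a)" "a \<notin> tuples k \<or> b \<notin> tuples k \<Longrightarrow> X a b = 0"
proof -
  show 0: "X a b = 0" if "a \<notin> tuples k \<or> b \<notin> tuples k" for a b
    using assms that unfolding Herm_def by blast
  show "X a b = cnj (X b a)"
  proof (cases "a \<in> tuples k \<and> b \<in> tuples k")
    case True
    then show ?thesis using assms unfolding Herm_def by blast
  next
    case False
    then show ?thesis using 0[of a b] 0[of b a] by auto
  qed
qed

lemma HermI:
  assumes "\<And>a b. a \<notin> tuples k \<or> b \<notin> tuples k \<Longrightarrow> X a b = 0"
    and "\<And>a b. a \<in> tuples k \<Longrightarrow> b \<in> tuples k \<Longrightarrow> X a b = cnj (X b a)"
  shows "X \<in> Herm k"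
  using assms unfolding Herm_def by blast

lemma ptranspose_Herm:
  assumes "X \<in> Herm (t + 1)"
  shows "ptranspose t s X \<in> Herm (t + 1)"
proof (rule HermI)
  fix a b :: "'a list"
  assume ab: "a \<in> tuples (t + 1)" "b \<in> tuples (t + 1)"
  show "ptranspose t s X a b = cnj (ptranspose t s X b a)"
    unfolding ptranspose_apply[OF ab] ptranspose_apply[OF ab(2,1)] by (rule HermD(1)[OF assms])
qed (auto simp: ptranspose_def)

lemma ptranspose_ptranspose:
  assumes "X \<in> Herm (t + 1)" "s \<le> t"
  shows "ptranspose t s (ptranspose t s X) = X"
proof (intro ext)
  fix a b
  show "ptranspose t s (ptranspose t s X) a b = X a b"
  proof (cases "a \<in> tuples (t + 1) \<and> b \<in> tuples (t + 1)")
    case True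
    then have ab: "a \<in> tuples (t + 1)" "b \<in> tuples (t + 1)" by auto
    show ?thesis
      using conj_swap_tuples[OF ab assms(2)] conj_swap_tuples[OF ab(2,1) assms(2)]
      by (simp only: ptranspose_apply ab conj_swap_conj_swap[OF _ _ assms(2)])
  next
    case False
    then show ?thesis using HermD(2)[OF assms(1), of a b] by (auto simp: ptranspose_def)
  qed
qed

text \<open>In the product of a conjugated and an unconjugated monomial, moving a factor from one to
  the other conjugates it.\<close>

lemma mon_conj_swap:
  "cnj (mon (conj_swap s a b) x) * z * mon (conj_swap s b a) x = cnj (wmon s a x) * z * wmon s b x"
  by (simp add: conj_swap_def wmon_def mult_ac)

lemma qform_ptranspose:
  fixes X :: "('n::finite, complex) tmat"
  assumes "s \<le> t"
  shows "qform (tuples (t + 1)) (ptranspose t s X) (\<lambda>a. wmon s a x) = qform (tuples (t + 1)) X (\<lambda>a. mon a x)"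
proof -
  have "qform (tuples (t + 1)) X (\<lambda>a. mon a x) = (\<Sum>a\<in>tuples (t + 1). \<Sum>b\<in>tuples (t + 1).
      cnj (mon (conj_swap s a b) x) * X (conj_swap s a b) (conj_swap s b a) * mon (conj_swap s b a) x)"
    unfolding qform_def
    by (rule sum_conj_swap[OF assms, of "\<lambda>a b. cnj (mon a x) * X a b * mon b x", symmetric])
  then show ?thesis
    unfolding mon_conj_swap qform_def by (simp only: ptranspose_apply cong: sum.cong)
qed

lemma hs_inner_ptranspose:
  fixes X Y :: "('n::finite, complex) tmat"
  assumes "s \<le> t"
  shows "hs_inner (t + 1) (ptranspose t s X) (ptranspose t s Y) = hs_inner (t + 1) X Y"
  unfolding hs_inner_def sum_conj_swap[OF assms, of "\<lambda>a b. cnj (X a b) * Y a b", symmetric]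
  by (simp only: ptranspose_apply cong: sum.cong)

lemma psd_iff: "psd k X \<longleftrightarrow> X \<in> Herm k \<and> pos_form (tuples k) X"
  by (simp add: psd_def pos_form_def qform_def)

text \<open>Factoring \<open>X\<close> into rank-one terms writes the pairing as a sum of values of
  the form of \<open>Y\<close>.\<close>

lemma hs_inner_pos_form_nonneg:
  fixes X Y :: "('n::finite, complex) tmat"
  assumes "pos_form (tuples k) X" "pos_form (tuples k) Y"
  shows "0 \<le> hs_inner k X Y"
proof -
  obtain m :: nat and g where g: "\<And>a b. a \<in> tuples k \<Longrightarrow> b \<in> tuples k \<Longrightarrow> X a b = (\<Sum>l<m. g l a * cnj (g l b))"
    using pos_form_factor[OF finite_tuples assms(1)] by blast
  have "hs_inner k X Y = (\<Sum>a\<in>tuples k. \<Sum>b\<in>tuples k. \<Sum>l<m. cnj (g l a) * Y a b * g l b)"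
    unfolding hs_inner_def using g by (simp add: sum_distrib_left mult_ac cong: sum.cong)
  also have "\<dots> = (\<Sum>l<m. qform (tuples k) Y (g l))"
    unfolding qform_def by (simp add: sum.swap[of _ "{..<m}"])
  also have "0 \<le> \<dots>" using assms(2) by (intro sum_nonneg) (simp add: pos_form_def)
  finally show ?thesis .
qed

text \<open>The \<open>k\<close>-th tensor power of the rank-one matrix \<open>x x^*\<close>, set to
  0 off the tuples so that it lies in \<open>Herm k\<close>.\<close>

definition ketbra :: "nat \<Rightarrow> ('n::finite \<Rightarrow> complex) \<Rightarrow> ('n, complex) tmat" where
  "ketbra k x a b = (if a \<in> tuples k \<and> b \<in> tuples k then mon a x * cnj (mon b x) else 0)"

lemma hs_inner_ketbra:
  fixes X :: "('n::finite, complex) tmat"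
  assumes "X \<in> Herm k"
  shows "hs_inner k X (ketbra k x) = qform (tuples k) X (\<lambda>a. mon a x)"
proof -
  have "hs_inner k X (ketbra k x) = (\<Sum>a\<in>tuples k. \<Sum>b\<in>tuples k. cnj (mon b x) * cnj (X a b) * mon a x)"
    by (simp add: hs_inner_def ketbra_def mult_ac cong: sum.cong)
  also have "\<dots> = (\<Sum>a\<in>tuples k. \<Sum>b\<in>tuples k. cnj (mon b x) * X b a * mon a x)"
    unfolding HermD(1)[OF assms, symmetric] ..
  finally show ?thesis unfolding qform_def by (subst (asm) sum.swap)
qed

lemma BS_if_sum_ketbra:
  fixes E :: "('n::finite \<Rightarrow> complex) set"
  shows "(\<lambda>a b. \<Sum>x\<in>E. of_real (r x) * ketbra k x a b) \<in> BS k"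
proof -
  have "(\<lambda>a b. \<Sum>x\<in>E. of_real (r x) * ketbra k x a b) \<in> Herm k"
    by (intro HermI) (auto simp: ketbra_def mult_ac)
  moreover have "ketbra k x a (permute_list \<sigma> b) = ketbra k x a b" if "b \<in> tuples k" "\<sigma> permutes {..<k}" for x :: "'n \<Rightarrow> complex" and a b \<sigma>
    using that mon_cong_mset[of "permute_list \<sigma> b" b] by (auto simp: ketbra_def tuples_def)
  ultimately show ?thesis by (auto simp: BS_def)
qed

lemma BS_perp_form_eq_0:
  assumes "B \<in> BS_perp k"
  shows "qform (tuples k) B (\<lambda>a. mon a x) = 0"
proof -
  have "(\<lambda>a b. \<Sum>y\<in>{x}. of_real 1 * ketbra k y a b) \<in> BS k" by (rule BS_if_sum_ketbra)
  then have "ketbra k x \<in> BS k" by simp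
  then show ?thesis using assms hs_inner_ketbra[of B k x] by (simp add: BS_perp_def)
qed

section \<open>Identity factors and the partial trace\<close>

lemma sum_tuples_add:
  "(\<Sum>a\<in>tuples (m + n). f a) = (\<Sum>a\<in>tuples m. \<Sum>b\<in>tuples n. f (a @ b))"
  unfolding sum.cartesian_product
  by (rule sum.reindex_bij_witness[where i = "\<lambda>(a, b). a @ b" and j = "\<lambda>a. (take m a, drop m a)"])
     (auto simp: tuples_def)

lemma tensor_power_id_mat: "tensor_power (id_mat 1) m = (id_mat m :: ('n::finite, complex) tmat)"
proof (induction m)
  case (Suc m)
  show ?case
    unfolding tensor_power.simps Suc
  proof (intro ext)
    fix a b :: "'n list"
    show "tensor 1 (id_mat 1) (id_mat m) a b = (id_mat (Suc m) a b :: complex)"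
      by (cases a; cases b) (auto simp: tensor_def id_mat_def tuples_def)
  qed
qed simp

lemma tensor_id_mat_append:
  assumes "a \<in> tuples k" "b \<in> tuples k" "g \<in> tuples m"
  shows "tensor k X (id_mat m) (a @ g) (b @ h) = (if g = h then X a b else 0)"
  using assms by (auto simp: tensor_def id_mat_def tuples_def)

lemma tensor_id_mat_Herm:
  assumes "X \<in> Herm k"
  shows "tensor k X (id_mat m) \<in> Herm (k + m)"
proof (rule HermI)
  fix a b :: "'a list"
  show "tensor k X (id_mat m) a b = cnj (tensor k X (id_mat m) b a)"
    unfolding tensor_def complex_cnj_mult HermD(1)[OF assms, symmetric] by (auto simp: id_mat_def)
  assume *: "a \<notin> tuples (k + m) \<or> b \<notin> tuples (k + m)"
  have "c \<in> tuples (k + m)" if "take k c \<in> tuples k" "drop k c \<in> tuples m" for c :: "'a list"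
    using that length_append[of "take k c" "drop k c"] by (simp add: tuples_def del: length_take length_drop)
  then have "take k a \<notin> tuples k \<or> take k b \<notin> tuples k \<or> drop k a \<notin> tuples m \<or> drop k b \<notin> tuples m"
    using * by blast
  then show "tensor k X (id_mat m) a b = 0"
    using HermD(2)[OF assms, of "take k a" "take k b"] by (auto simp: tensor_def id_mat_def)
qed

text \<open>Tensoring with the identity is adjoint to the partial trace over the last
  \<open>m\<close> factors.\<close>

lemma hs_inner_tensor_id_mat:
  "hs_inner (k + m) (tensor k X (id_mat m)) Y =
   (\<Sum>a\<in>tuples k. \<Sum>b\<in>tuples k. cnj (X a b) * (\<Sum>h\<in>tuples m. Y (a @ h) (b @ h)))"
proof -
  have "hs_inner (k + m) (tensor k X (id_mat m)) Y =
     (\<Sum>a\<in>tuples k. \<Sum>g\<in>tuples m. \<Sum>b\<in>tuples k. \<Sum>h\<in>tuples m. if g = h then cnj (X a b) * Y (a @ g) (b @ g) else 0)"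
    unfolding hs_inner_def sum_tuples_add
    by (intro sum.cong) (auto simp: tensor_id_mat_append)
  also have "\<dots> = (\<Sum>a\<in>tuples k. \<Sum>b\<in>tuples k. \<Sum>g\<in>tuples m. cnj (X a b) * Y (a @ g) (b @ g))"
    by (simp add: sum.swap[of _ "tuples m"] cong: sum.cong)
  finally show ?thesis by (simp add: sum_distrib_left)
qed

text \<open>The origin of the power of the squared norm in (ii): each position summed over
  contributes one factor.\<close>

lemma sum_mon_tuples:
  fixes x :: "'n::finite \<Rightarrow> complex"
  shows "(\<Sum>h\<in>tuples m. mon h x * cnj (mon h x)) = (\<Sum>i\<in>UNIV. x i * cnj (x i)) ^ m"
proof (induction m)
  case 0
  have "tuples 0 = {[] :: 'n list}" by (auto simp: tuples_def)
  then show ?case by simp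
next
  case (Suc m)
  have "(\<Sum>h\<in>tuples 1. mon h x * cnj (mon h x)) = (\<Sum>i\<in>UNIV. x i * cnj (x i))"
    by (rule sum.reindex_bij_witness[where i = "\<lambda>i. [i]" and j = hd])
       (auto simp: tuples_def length_Suc_conv)
  moreover have "(\<Sum>h\<in>tuples (1 + m). mon h x * cnj (mon h x)) =
     (\<Sum>a\<in>tuples 1. mon a x * cnj (mon a x)) * (\<Sum>h\<in>tuples m. mon h x * cnj (mon h x))"
    unfolding sum_tuples_add sum_product by (simp add: mult_ac)
  ultimately show ?case using Suc by simp
qed

section \<open>Evaluation of formal polynomials\<close>

abbreviation "lookup \<equiv> Poly_Mapping.lookup"
abbreviation "keys \<equiv> Poly_Mapping.keys"

definition mval :: "(('n + 'n) \<Rightarrow>\<^sub>0 nat) \<Rightarrow> ('n::finite \<Rightarrow> complex) \<Rightarrow> complex" where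
  "mval m x = (\<Prod>i\<in>UNIV. x i ^ lookup m (Inl i) * cnj (x i) ^ lookup m (Inr i))"

definition ev :: "'n::finite cpoly \<Rightarrow> ('n \<Rightarrow> complex) \<Rightarrow> complex" where
  "ev p x = (\<Sum>m\<in>keys p. lookup p m * mval m x)"

lemma mval_0 [simp]: "mval 0 x = 1"
  by (simp add: mval_def)

lemma mval_add: "mval (m + n) x = mval m x * mval n x"
  by (simp add: mval_def lookup_add power_add prod.distrib mult_ac)

lemma mval_swap_monom: "mval (swap_monom m) x = cnj (mval m x)"
  by (simp add: mval_def lookup_swap_monom swap_var_def mult.commute)

lemma ev_superset: "finite T \<Longrightarrow> keys p \<subseteq> T \<Longrightarrow> ev p x = (\<Sum>m\<in>T. lookup p m * mval m x)"
  unfolding ev_def by (rule sum.mono_neutral_left) (auto simp: in_keys_iff)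

lemma ev_0 [simp]: "ev 0 x = 0"
  by (simp add: ev_def)

lemma ev_add: "ev (p + q) x = ev p x + ev q x"
proof -
  have "ev (p + q) x = (\<Sum>m\<in>keys p \<union> keys q. lookup (p + q) m * mval m x)"
    using Poly_Mapping.keys_add[of p q] by (intro ev_superset) auto
  also have "\<dots> = ev p x + ev q x"
    by (simp add: ev_superset[of "keys p \<union> keys q"] lookup_add distrib_right sum.distrib)
  finally show ?thesis .
qed

lemma ev_sum: "ev (\<Sum>i\<in>I. p i) x = (\<Sum>i\<in>I. ev (p i) x)"
  by (induction I rule: infinite_finite_induct) (simp_all add: ev_add)

lemma ev_single [simp]: "ev (Poly_Mapping.single m c) x = c * mval m x"
  by (simp add: ev_def)

lemma poly_mapping_sum_singles: "p = (\<Sum>m\<in>keys p. Poly_Mapping.single m (lookup p m))"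
  by (rule poly_mapping_eqI)
     (simp add: lookup_sum lookup_single when_def in_keys_iff)

lemma ev_mult: "ev (p * q) x = ev p x * ev q x"
proof -
  have "p * q = (\<Sum>m\<in>keys p. Poly_Mapping.single m (lookup p m)) * (\<Sum>m\<in>keys q. Poly_Mapping.single m (lookup q m))"
    using poly_mapping_sum_singles[of p] poly_mapping_sum_singles[of q] by simp
  then have "ev (p * q) x = (\<Sum>m\<in>keys p. \<Sum>n\<in>keys q. lookup p m * mval m x * (lookup q n * mval n x))"
    by (simp add: sum_product mult_single ev_sum mval_add mult_ac)
  then show ?thesis by (simp add: ev_def sum_product)
qed

lemma ev_power: "ev (p ^ n) x = ev p x ^ n"
  by (induction n) (simp_all add: ev_mult flip: single_one)

lemma ev_Const [simp]: "ev (Const c) x = c"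
  by (simp add: Const_def)

lemma ev_Var [simp]: "ev (Var i) x = x i"
proof -
  have "mval (Poly_Mapping.single (Inl i) 1) x = (\<Prod>j\<in>UNIV. if j = i then x j else 1)"
    unfolding mval_def by (intro prod.cong) (auto simp: lookup_single)
  then show ?thesis by (simp add: Var_def)
qed

lemma ev_Var_conj [simp]: "ev (Var_conj i) x = cnj (x i)"
proof -
  have "mval (Poly_Mapping.single (Inr i) 1) x = (\<Prod>j\<in>UNIV. if j = i then cnj (x j) else 1)"
    unfolding mval_def by (intro prod.cong) (auto simp: lookup_single)
  then show ?thesis by (simp add: Var_conj_def)
qed

lemma keys_conj_poly: "keys (conj_poly q) = swap_monom ` keys q"
proof -
  have "m \<in> swap_monom ` keys q" if "m \<in> keys (conj_poly q)" for m
    using that by (intro image_eqI[of _ _ "swap_monom m"]) (auto simp: in_keys_iff lookup_conj_poly)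
  then show ?thesis by (auto simp: in_keys_iff lookup_conj_poly)
qed

lemma ev_conj_poly: "ev (conj_poly q) x = cnj (ev q x)"
  unfolding ev_def keys_conj_poly
  by (subst sum.reindex)
     (auto intro: inj_on_subset[OF inj_swap_monom] simp: lookup_conj_poly mval_swap_monom)

text \<open>Although formal conjugates are evaluated at the conjugates of the \<open>x i\<close>,
  monomials stay linearly independent as functions, so identities in the ring can be checked on
  values.\<close>

lemma ev_inject:
  fixes p q :: "'n::finite cpoly"
  assumes "\<And>x. ev p x = ev q x"
  shows "p = q"
proof (rule poly_mapping_eqI)
  fix m
  define T where "T = insert m (keys p \<union> keys q)"
  have T: "finite T" "keys p \<subseteq> T" "keys q \<subseteq> T" by (auto simp: T_def)
  have "(\<Sum>n\<in>T. (lookup p n - lookup q n) *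
      (\<Prod>i\<in>UNIV. x i ^ lookup n (Inl i) * cnj (x i) ^ lookup n (Inr i))) = 0" for x
    using assms[of x] unfolding ev_superset[OF T(1,2)] ev_superset[OF T(1,3)]
    by (simp add: left_diff_distrib sum_subtractf flip: mval_def)
  from conj_monomial_sum_coeff_eq_0[OF finite T(1) this, of "\<lambda>i. lookup m (Inl i)" "\<lambda>i. lookup m (Inr i)"]
  have "(\<Sum>n | n \<in> T \<and> (\<forall>i\<in>UNIV. lookup n (Inl i) = lookup m (Inl i) \<and> lookup n (Inr i) = lookup m (Inr i)).
      lookup p n - lookup q n) = 0" .
  also have "{n \<in> T. \<forall>i\<in>UNIV. lookup n (Inl i) = lookup m (Inl i) \<and> lookup n (Inr i) = lookup m (Inr i)} = {m}"
  proof -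
    have "n = m" if "\<forall>i. lookup n (Inl i) = lookup m (Inl i) \<and> lookup n (Inr i) = lookup m (Inr i)" for n
    proof (rule poly_mapping_eqI)
      fix v show "lookup n v = lookup m v" using that by (cases v) auto
    qed
    then show ?thesis by (auto simp: T_def)
  qed
  finally show "lookup p m = lookup q m" by simp
qed

section \<open>Sums of squares in the polynomial ring\<close>

lemma r_sos_add_square:
  assumes "r_sos p" "hermitian_poly h"
  shows "r_sos (p + h\<^sup>2)"
proof -
  from assms(1) obtain m :: nat and q where q: "\<And>l. l < m \<Longrightarrow> hermitian_poly (q l)" "p = (\<Sum>l<m. (q l)\<^sup>2)"
    by (auto simp: r_sos_def)
  have "(\<Sum>l<m. ((q(m := h)) l)\<^sup>2) = p" unfolding q(2) by (intro sum.cong) auto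
  then show ?thesis unfolding r_sos_def using q(1) assms(2)
    by (intro exI[of _ "Suc m"] exI[of _ "q(m := h)"]) auto
qed

text \<open>The real and imaginary parts of \<open>h\<close> are Hermitian polynomials, and the
  squared modulus is the sum of their squares.\<close>

lemma r_sos_add_norm_square:
  fixes p h :: "'n::finite cpoly"
  assumes "r_sos p"
  shows "r_sos (p + h * conj_poly h)"
proof -
  define a where "a = Const (1/2) * (h + conj_poly h)"
  define b where "b = Const (- \<i>/2) * (h + Const (-1) * conj_poly h)"
  have ev: "ev a x = of_real (Re (ev h x))" "ev b x = of_real (Im (ev h x))" for x
    by (simp_all add: a_def b_def ev_mult ev_add ev_conj_poly complex_eq_iff)
  have "hermitian_poly a" "hermitian_poly b"
    unfolding hermitian_poly_def by (auto intro!: ev_inject simp: ev_conj_poly ev)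
  then have "r_sos (p + a\<^sup>2 + b\<^sup>2)" using assms by (intro r_sos_add_square)
  also have "p + a\<^sup>2 + b\<^sup>2 = p + h * conj_poly h"
    by (rule ev_inject)
       (simp add: ev_add ev_power ev_mult ev_conj_poly ev complex_mult_cnj)
  finally show ?thesis .
qed

lemma r_sos_sum_norm_squares:
  fixes h :: "'l \<Rightarrow> 'n::finite cpoly"
  shows "finite L \<Longrightarrow> r_sos (\<Sum>l\<in>L. h l * conj_poly (h l))"
proof (induction L rule: finite_induct)
  case empty
  show ?case by (auto simp: r_sos_def intro: exI[of _ 0])
next
  case (insert l L)
  then show ?case using r_sos_add_norm_square[of "\<Sum>l\<in>L. h l * conj_poly (h l)" "h l"]
    by (simp add: add.commute)
qed

lemma ev_prod_list_Var:
  "ev (prod_list (map Var a)) x = mon a x" "ev (prod_list (map Var_conj a)) x = cnj (mon a x)"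
  by (induction a) (simp_all add: ev_mult flip: single_one)

definition wmon_poly :: "nat \<Rightarrow> 'n list \<Rightarrow> 'n cpoly" where
  "wmon_poly s a = prod_list (map Var (take 1 a)) * prod_list (map Var_conj (take s (drop 1 a))) *
      prod_list (map Var (drop (1 + s) a))"

lemma ev_wmon_poly: "ev (wmon_poly s a) x = wmon s a x"
  by (simp add: wmon_poly_def ev_mult ev_prod_list_Var wmon_def)

text \<open>The identity factors sum out the last \<open>t - 1\<close> positions of the tensor
  power, which gives the power of the norm polynomial and leaves the form of
  \<open>M\<close>.\<close>

lemma ev_form_poly:
  assumes "t \<ge> 1"
  shows "ev (norm_sq_poly ^ (t - 1) * form_poly M) x =
    hs_inner (t + 1) (tensor 2 M (id_mat (t - 1))) (ketbra (t + 1) x)"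
proof -
  have t: "t + 1 = 2 + (t - 1)" using assms by simp
  have xx: "ev (tensor 1 xx_star xx_star a b) x = mon a x * cnj (mon b x)"
    if "a \<in> tuples 2" "b \<in> tuples 2" for a b :: "'a list"
  proof -
    from that obtain i j k l where "a = [i, j]" "b = [k, l]"
      by (auto simp: tuples_def numeral_2_eq_2 length_Suc_conv)
    then show ?thesis by (simp add: tensor_def xx_star_def tuples_def ev_mult mult_ac)
  qed
  have "hs_inner (t + 1) (tensor 2 M (id_mat (t - 1))) (ketbra (t + 1) x) =
      (\<Sum>a\<in>tuples 2. \<Sum>b\<in>tuples 2. cnj (M a b) * (\<Sum>h\<in>tuples (t - 1). ketbra (t + 1) x (a @ h) (b @ h)))"
    unfolding t by (simp only: hs_inner_tensor_id_mat diff_add_inverse)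
  also have "\<dots> = (\<Sum>a\<in>tuples 2. \<Sum>b\<in>tuples 2. cnj (M a b) *
      (mon a x * cnj (mon b x) * (\<Sum>h\<in>tuples (t - 1). mon h x * cnj (mon h x))))"
    unfolding sum_distrib_left using assms
    by (intro sum.cong) (auto simp: ketbra_def tuples_def mult_ac)
  also have "\<dots> = (\<Sum>i\<in>UNIV. x i * cnj (x i)) ^ (t - 1) *
      (\<Sum>a\<in>tuples 2. \<Sum>b\<in>tuples 2. cnj (M a b) * (mon a x * cnj (mon b x)))"
    unfolding sum_mon_tuples by (simp add: sum_distrib_left mult_ac)
  also have "\<dots> = ev (norm_sq_poly ^ (t - 1) * form_poly M) x"
    by (simp add: ev_mult ev_power norm_sq_poly_def form_poly_def ev_sum xx del: One_nat_def cong: sum.cong)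
  finally show ?thesis ..
qed

text \<open>For \<open>k = 0\<close> a bounded polynomial is constant. For larger \<open>k\<close>
  the bound forces a root at 0, and dividing by the variable lowers \<open>k\<close> by one.\<close>

lemma real_poly_eq_monom_if_growth:
  fixes Q :: "real poly"
  assumes "\<And>r. (poly Q r)\<^sup>2 \<le> C * r ^ (2 * k)"
  shows "Q = monom (coeff Q k) k"
  using assms
proof (induction k arbitrary: Q)
  case 0
  have "degree Q = 0"
  proof (rule ccontr)
    assume "degree Q \<noteq> 0"
    then have "filterlim (poly Q) at_infinity at_infinity"
      by (intro filterlim_poly_at_infinity) auto
    then have "eventually (\<lambda>r. C + 1 \<le> norm (poly Q r)) at_infinity"
      unfolding filterlim_at_infinity[OF order_refl] by (cases "0 < C + 1") (auto intro: always_eventually order_trans[OF _ norm_ge_zero])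
    then obtain b where "\<And>r. b \<le> norm r \<Longrightarrow> C + 1 \<le> norm (poly Q r)"
      unfolding eventually_at_infinity by blast
    from this[of "\<bar>b\<bar>"] have "C + 1 \<le> \<bar>poly Q \<bar>b\<bar>\<bar>" by simp
    then obtain r where "C + 1 \<le> \<bar>poly Q r\<bar>" by blast
    \<comment> \<open>This turns the lower bound \<open>C + 1\<close> on the modulus into a lower
      bound on the square that still exceeds \<open>C\<close>.\<close>
    moreover have "\<bar>poly Q r\<bar> \<le> (poly Q r)\<^sup>2 + 1 / 4"
      using zero_le_power2[of "\<bar>poly Q r\<bar> - 1 / 2"] by (simp add: power2_diff power_divide)
    ultimately show False using 0[of r] by simp
  qed
  then show ?case by (auto elim: degree_eq_zeroE simp: monom_0)
next
  case (Suc k)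
  have "poly Q 0 = 0" using Suc.prems[of 0] by simp
  then obtain Q' where Q: "Q = pCons 0 Q'" by (cases Q) auto
  have nz: "(poly Q' r)\<^sup>2 \<le> C * r ^ (2 * k)" if "r \<noteq> 0" for r
  proof -
    have "r\<^sup>2 * (poly Q' r)\<^sup>2 \<le> r\<^sup>2 * (C * r ^ (2 * k))"
      using Suc.prems[of r] by (simp add: Q power_mult_distrib power2_eq_square mult_ac)
    then show ?thesis using that by (simp add: mult_le_cancel_left)
  qed
  have "(poly Q' r)\<^sup>2 \<le> C * r ^ (2 * k)" for r
  proof (cases "r = 0")
    case True
    \<comment> \<open>Division gives the bound only away from 0; continuity supplies it at
      0.\<close>
    have lim: "((\<lambda>r. (poly Q' r)\<^sup>2) \<longlongrightarrow> (poly Q' 0)\<^sup>2) (at 0)" "((\<lambda>r. C * r ^ (2 * k)) \<longlongrightarrow> C * 0 ^ (2 * k)) (at 0)"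
      by (intro tendsto_intros poly_isCont[unfolded isCont_def])+
    show ?thesis unfolding True
      by (rule tendsto_le[OF _ lim(2,1)]) (auto simp: eventually_at_filter nz)
  qed (use nz in auto)
  then have "Q' = monom (coeff Q' k) k" by (rule Suc.IH)
  then show ?case by (metis Q coeff_pCons_Suc monom_Suc)
qed

section \<open>Bihomogeneous sums of squares\<close>

definition degl :: "(('n::finite + 'n) \<Rightarrow>\<^sub>0 nat) \<Rightarrow> nat" where
  "degl m = (\<Sum>i\<in>UNIV. lookup m (Inl i))"

definition degr :: "(('n::finite + 'n) \<Rightarrow>\<^sub>0 nat) \<Rightarrow> nat" where
  "degr m = (\<Sum>i\<in>UNIV. lookup m (Inr i))"

definition bidegree_part :: "'n::finite cpoly \<Rightarrow> nat \<Rightarrow> nat \<Rightarrow> ('n \<Rightarrow> complex) \<Rightarrow> complex" where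
  "bidegree_part q i j x = (\<Sum>m | m \<in> keys q \<and> degl m = i \<and> degr m = j. lookup q m * mval m x)"

lemma mval_scale: "mval m (\<lambda>i. z * x i) = z ^ degl m * cnj z ^ degr m * mval m x"
  by (simp add: mval_def degl_def degr_def power_mult_distrib prod.distrib power_sum mult_ac)

lemma deg_swap_monom [simp]: "degl (swap_monom m) = degr m" "degr (swap_monom m) = degl m"
  by (simp_all add: degl_def degr_def lookup_swap_monom swap_var_def)

lemma hermitian_lookup_swap:
  assumes "hermitian_poly q"
  shows "lookup q (swap_monom m) = cnj (lookup q m)"
  using lookup_conj_poly[of q "swap_monom m"] assms by (simp add: hermitian_poly_def)

lemma hermitian_cnj_sum:
  assumes "hermitian_poly q" "\<And>m. P m \<longleftrightarrow> R (swap_monom m)"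
  shows "cnj (\<Sum>m | m \<in> keys q \<and> P m. lookup q m * mval m x) = (\<Sum>m | m \<in> keys q \<and> R m. lookup q m * mval m x)"
  unfolding cnj_sum
  by (rule sum.reindex_bij_witness[where i = swap_monom and j = swap_monom])
     (auto simp: in_keys_iff hermitian_lookup_swap[OF assms(1)] mval_swap_monom assms(2))

lemma cnj_bidegree_part:
  "hermitian_poly q \<Longrightarrow> cnj (bidegree_part q i j x) = bidegree_part q j i x"
  unfolding bidegree_part_def by (rule hermitian_cnj_sum) auto

lemma hermitian_ev_real: "hermitian_poly q \<Longrightarrow> of_real (Re (ev q x)) = ev q x"
  using ev_conj_poly[of q x] by (simp add: hermitian_poly_def complex_eq_iff)

text \<open>Along a real ray each square is dominated by a multiple of \<open>r\<^sup>2\<^sup>k\<close>, which kills every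
  homogeneous component of degree other than \<open>k\<close>.\<close>

lemma sos_homogeneous:
  fixes q :: "nat \<Rightarrow> 'n::finite cpoly"
  assumes herm: "\<And>l. l < m \<Longrightarrow> hermitian_poly (q l)"
    and P: "\<And>x. P x = (\<Sum>l<m. (ev (q l) x)\<^sup>2)"
    and hom: "\<And>z x. P (\<lambda>i. z * x i) = (z * cnj z) ^ k * P x"
    and l: "l < m"
  shows "ev (q l) x = (\<Sum>n | n \<in> keys (q l) \<and> degl n + degr n = k. lookup (q l) n * mval n x)"
proof -
  define H where "H = (\<Sum>n | n \<in> keys (q l) \<and> degl n + degr n = k. lookup (q l) n * mval n x)"
  \<comment> \<open>The restriction of \<open>q l\<close> to the real ray through \<open>x\<close>.
    Values of a Hermitian polynomial are real, so real parts of the coefficients suffice.\<close>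
  define Q where "Q = (\<Sum>n\<in>keys (q l). monom (Re (lookup (q l) n * mval n x)) (degl n + degr n))"
  have Qev: "poly Q r = Re (ev (q l) (\<lambda>i. of_real r * x i))" for r
    unfolding Q_def poly_sum poly_monom ev_def Re_sum
    by (intro sum.cong)
       (auto simp: mval_scale power_add algebra_simps simp flip: of_real_power)
  have "(poly Q r)\<^sup>2 \<le> Re (P x) * r ^ (2 * k)" for r
  proof -
    define y where "y = (\<lambda>i. of_real r * x i)"
    have "(poly Q r)\<^sup>2 \<le> (\<Sum>l<m. (Re (ev (q l) y))\<^sup>2)"
      unfolding Qev y_def using l by (intro member_le_sum) auto
    also have "\<dots> = Re (\<Sum>l<m. (of_real (Re (ev (q l) y)))\<^sup>2)"
      by (simp flip: of_real_power)
    also have "\<dots> = Re (P y)"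
      unfolding P using herm by (simp add: hermitian_ev_real)
    also have "\<dots> = Re (P x) * r ^ (2 * k)"
      unfolding y_def hom by (simp add: power_mult power2_eq_square flip: of_real_mult of_real_power)
    finally show ?thesis .
  qed
  then have "poly Q 1 = poly (monom (coeff Q k) k) 1"
    using real_poly_eq_monom_if_growth by metis
  then have "Re (ev (q l) x) = coeff Q k" by (simp add: Qev poly_monom)
  also have "\<dots> = Re H"
    by (simp add: H_def Q_def coeff_sum sum.inter_filter[symmetric])
  finally have "Re (ev (q l) x) = Re H" .
  moreover have "cnj H = H"
    unfolding H_def by (rule hermitian_cnj_sum[OF herm[OF l]]) (simp add: add.commute)
  ultimately show ?thesis
    using hermitian_ev_real[OF herm[OF l], of x] unfolding H_def[symmetric] by (simp add: complex_eq_iff)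
qed

text \<open>Phase averaging in algebraic form: for fixed \<open>x\<close>, the sum of the squares of
  the polynomials \<open>R l\<close> agrees with \<open>P x * v ^ k\<close> on the unit circle,
  hence identically. In the coefficient of \<open>v ^ k\<close>, the coefficients of
  \<open>R l\<close> at \<open>i\<close> and \<open>k - i\<close> meet, and these are
  conjugate.\<close>

lemma sos_bihomogeneous:
  fixes q :: "nat \<Rightarrow> 'n::finite cpoly"
  assumes herm: "\<And>l. l < m \<Longrightarrow> hermitian_poly (q l)"
    and P: "\<And>x. P x = (\<Sum>l<m. (ev (q l) x)\<^sup>2)"
    and hom: "\<And>z x. P (\<lambda>i. z * x i) = (z * cnj z) ^ k * P x"
  shows "P x = (\<Sum>l<m. \<Sum>i\<le>k. of_real ((cmod (bidegree_part (q l) i (k - i) x))\<^sup>2))"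
proof -
  define N where "N l = {n \<in> keys (q l). degl n + degr n = k}" for l
  define R where "R l = (\<Sum>n\<in>N l. monom (lookup (q l) n * mval n x) (degl n))" for l
  have finN: "finite (N l)" for l by (simp add: N_def)
  have R: "coeff (R l) i = bidegree_part (q l) i (k - i) x" if "i \<le> k" for l i
  proof -
    have "coeff (R l) i = (\<Sum>n | n \<in> N l \<and> degl n = i. lookup (q l) n * mval n x)"
      using finN[of l] by (simp add: R_def coeff_sum sum.inter_filter[symmetric])
    also have "{n \<in> N l. degl n = i} = {n \<in> keys (q l). degl n = i \<and> degr n = k - i}"
      using that by (auto simp: N_def)
    finally show ?thesis by (simp add: bidegree_part_def)
  qed
  define T where "T = (\<Sum>l<m. (R l)\<^sup>2) - monom (P x) k"
  have "poly T v = 0" if "cmod v = 1" for v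
  proof -
    \<comment> \<open>The phase \<open>u\<close> acts on a term through the exponent
      \<open>degl n - degr n = 2 * degl n - k\<close>; after multiplication by \<open>u ^ k\<close>
      only powers of \<open>u\<close> squared remain.\<close>
    define u where "u = csqrt v"
    have u2: "u\<^sup>2 = v" by (simp add: u_def)
    have "(cmod u)\<^sup>2 = 1" using that u2 by (metis norm_power)
    then have uu: "u * cnj u = 1" by (simp add: complex_norm_square[symmetric])
    have *: "u ^ k * ev (q l) (\<lambda>i. u * x i) = poly (R l) v" if "l < m" for l
    proof -
      have "ev (q l) (\<lambda>i. u * x i) = (\<Sum>n\<in>N l. lookup (q l) n * mval n (\<lambda>i. u * x i))"
        unfolding N_def using sos_homogeneous[OF herm P hom that] by simp
      also have "u ^ k * \<dots> = (\<Sum>n\<in>N l. lookup (q l) n * mval n x * v ^ degl n)"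
        unfolding sum_distrib_left
      proof (rule sum.cong)
        fix n assume "n \<in> N l"
        then have k: "k = degl n + degr n" by (simp add: N_def)
        have "u ^ k * (u ^ degl n * cnj u ^ degr n) = (u ^ degl n * u ^ degl n) * (u * cnj u) ^ degr n"
          unfolding k by (simp add: power_add power_mult_distrib mult_ac)
        also have "\<dots> = v ^ degl n" by (simp add: uu power2_eq_square power_mult_distrib flip: u2)
        finally show "u ^ k * (lookup (q l) n * mval n (\<lambda>i. u * x i)) = lookup (q l) n * mval n x * v ^ degl n"
          by (simp add: mval_scale mult_ac)
      qed simp
      finally show ?thesis by (simp add: R_def poly_sum poly_monom)
    qed
    have "(\<Sum>l<m. (poly (R l) v)\<^sup>2) = (u ^ k)\<^sup>2 * P (\<lambda>i. u * x i)"
      unfolding P sum_distrib_left by (intro sum.cong) (auto simp: power_mult_distrib simp flip: *)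
    also have "\<dots> = v ^ k * P x" unfolding hom uu by (simp flip: u2 power_mult add: mult.commute)
    finally show ?thesis by (simp add: T_def poly_sum poly_monom mult.commute)
  qed
  then have "{z. cmod z = 1} \<subseteq> {z. poly T z = 0}" by auto
  then have "T = 0" using infinite_unit_circle poly_roots_finite finite_subset by blast
  then have "coeff T k = 0" by simp
  then have "P x = (\<Sum>l<m. \<Sum>i\<le>k. coeff (R l) i * coeff (R l) (k - i))"
    by (simp add: T_def coeff_sum power2_eq_square coeff_mult)
  also have "\<dots> = (\<Sum>l<m. \<Sum>i\<le>k. of_real ((cmod (bidegree_part (q l) i (k - i) x))\<^sup>2))"
  proof (intro sum.cong refl)
    fix l i assume "l \<in> {..<m}" "i \<in> {..k}"
    then have "coeff (R l) (k - i) = cnj (coeff (R l) i)"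
      using cnj_bidegree_part[OF herm, of l i "k - i" x] by (simp add: R)
    then show "coeff (R l) i * coeff (R l) (k - i) = of_real ((cmod (bidegree_part (q l) i (k - i) x))\<^sup>2)"
      using \<open>i \<in> _\<close> R[of i l] by (simp only: complex_norm_square) simp
  qed
  finally show ?thesis .
qed

lemma ex_tuple_count:
  fixes f :: "'n::finite \<Rightarrow> nat"
  shows "\<exists>a. length a = (\<Sum>i\<in>UNIV. f i) \<and> (\<forall>i. count_list a i = f i)"
proof -
  define A where "A = Abs_multiset f"
  have A: "count A = f" unfolding A_def by (rule Abs_multiset_inverse) simp
  obtain a where a: "mset a = A" using ex_mset by blast
  then have c: "count_list a i = f i" for i using A by (metis count_mset)
  moreover have "length a = (\<Sum>i\<in>UNIV. f i)"
    using sum_count_set[of a UNIV] by (simp add: c)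
  ultimately show ?thesis by blast
qed

text \<open>Position 0 carries an unconjugated variable; \<open>s < k\<close> ensures that the
  monomial has one to put there.\<close>

lemma mval_eq_wmon:
  assumes "degl m = k - s" "degr m = s" "s < k"
  shows "\<exists>a\<in>tuples k. \<forall>x. mval m x = wmon s a x"
proof -
  obtain b where b: "length b = k - s" "\<And>i. count_list b i = lookup m (Inl i)"
    using ex_tuple_count[of "\<lambda>i. lookup m (Inl i)"] assms(1) by (auto simp: degl_def)
  obtain c where c: "length c = s" "\<And>i. count_list c i = lookup m (Inr i)"
    using ex_tuple_count[of "\<lambda>i. lookup m (Inr i)"] assms(2) by (auto simp: degr_def)
  obtain i d where d: "b = i # d" using b(1) assms(3) by (cases b) auto
  have "wmon s (i # c @ d) x = mon b x * cnj (mon c x)" for x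
    using c(1) by (simp add: wmon_def d mult_ac)
  also have "mon b x * cnj (mon c x) = mval m x" for x
    by (simp add: mon_eq_prod_count b c mval_def prod.distrib)
  finally show ?thesis using b(1) c(1) d assms(3)
    by (intro bexI[of _ "i # c @ d"]) (auto simp: tuples_def)
qed

lemma bidegree_part_eq_sum_wmon:
  assumes "s < k"
  shows "\<exists>v. \<forall>x. bidegree_part q (k - s) s x = (\<Sum>a\<in>tuples k. v a * wmon s a x)"
proof -
  define N where "N = {m \<in> keys q. degl m = k - s \<and> degr m = s}"
  have "\<forall>m\<in>N. \<exists>a. a \<in> tuples k \<and> (\<forall>x. mval m x = wmon s a x)"
    using mval_eq_wmon[OF _ _ assms] by (force simp: N_def)
  then obtain g where g: "\<And>m. m \<in> N \<Longrightarrow> g m \<in> tuples k" "\<And>m x. m \<in> N \<Longrightarrow> mval m x = wmon s (g m) x"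
    by metis
  have fin: "finite N" by (simp add: N_def)
  have "bidegree_part q (k - s) s x = (\<Sum>a\<in>tuples k. (\<Sum>m | m \<in> N \<and> g m = a. lookup q m) * wmon s a x)" for x
  proof -
    have "bidegree_part q (k - s) s x = (\<Sum>m\<in>N. lookup q m * wmon s (g m) x)"
      unfolding bidegree_part_def N_def[symmetric] using g by (intro sum.cong) auto
    also have "\<dots> = (\<Sum>a\<in>tuples k. \<Sum>m | m \<in> N \<and> g m = a. lookup q m * wmon s (g m) x)"
      using g(1) fin by (intro sum.group[symmetric]) auto
    also have "\<dots> = (\<Sum>a\<in>tuples k. (\<Sum>m | m \<in> N \<and> g m = a. lookup q m) * wmon s a x)"
      unfolding sum_distrib_right by (intro sum.cong) auto
    finally show ?thesis .
  qed
  then show ?thesis by (intro exI[of _ "\<lambda>a. \<Sum>m | m \<in> N \<and> g m = a. lookup q m"]) simp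
qed

section \<open>Equivalence of the certificates\<close>

lemma hs_inner_ptrace:
  assumes "t \<ge> 1"
  shows "hs_inner 2 M (ptrace t \<rho>) = hs_inner (t + 1) (tensor 2 M (id_mat (t - 1))) \<rho>"
proof -
  have t: "t + 1 = 2 + (t - 1)" using assms by simp
  show ?thesis
    unfolding t hs_inner_tensor_id_mat by (simp add: hs_inner_def ptrace_def cong: sum.cong)
qed

lemma ptrace_Herm:
  assumes "\<rho> \<in> Herm (t + 1)"
  shows "ptrace t \<rho> \<in> Herm 2"
proof (rule HermI)
  fix a b :: "'a list"
  assume ab: "a \<in> tuples 2" "b \<in> tuples 2"
  have "(\<Sum>h\<in>tuples (t - 1). \<rho> (a @ h) (b @ h)) = (\<Sum>h\<in>tuples (t - 1). cnj (\<rho> (b @ h) (a @ h)))"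
    by (intro sum.cong refl HermD(1)[OF assms])
  then show "ptrace t \<rho> a b = cnj (ptrace t \<rho> b a)" using ab by (simp add: ptrace_def)
qed (auto simp: ptrace_def)

lemma qform_diff_sum:
  "qform A (\<lambda>a b. X a b - (\<Sum>s\<in>S. W s a b)) v = qform A X v - (\<Sum>s\<in>S. qform A (W s) v)"
proof -
  have "qform A (\<lambda>a b. \<Sum>s\<in>S. W s a b) v = (\<Sum>s\<in>S. qform A (W s) v)"
    unfolding qform_def by (simp add: sum_distrib_left sum_distrib_right sum.swap[of _ S])
  moreover have "qform A (\<lambda>a b. X a b - Y a b) v = qform A X v - qform A Y v" for Y
    unfolding qform_def by (simp add: algebra_simps sum_subtractf)
  ultimately show ?thesis by simp
qed

lemma hs_inner_diff_sum:
  "hs_inner k (\<lambda>a b. X a b - (\<Sum>s\<in>S. W s a b)) \<rho> = hs_inner k X \<rho> - (\<Sum>s\<in>S. hs_inner k (W s) \<rho>)"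
proof -
  have "hs_inner k (\<lambda>a b. \<Sum>s\<in>S. W s a b) \<rho> = (\<Sum>s\<in>S. hs_inner k (W s) \<rho>)"
    unfolding hs_inner_def by (simp add: sum_distrib_right sum.swap[of _ S])
  moreover have "hs_inner k (\<lambda>a b. X a b - Y a b) \<rho> = hs_inner k X \<rho> - hs_inner k Y \<rho>" for Y
    unfolding hs_inner_def by (simp add: algebra_simps sum_subtractf)
  ultimately show ?thesis by simp
qed

text \<open>The common middle term of the equivalences: \<open>Z s\<close> corresponds to the
  partial transpose of \<open>W s\<close> in (iii), and \<open>B\<close> disappears because its form
  vanishes at tensor powers.\<close>

definition gram_cert :: "nat \<Rightarrow> nat \<Rightarrow> ('n::finite, complex) tmat \<Rightarrow> (nat \<Rightarrow> ('n, complex) tmat) \<Rightarrow> bool" where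
  "gram_cert t \<tau> N Z \<longleftrightarrow> (\<forall>s\<le>\<tau>. psd (t + 1) (Z s)) \<and>
     (\<forall>x. qform (tuples (t + 1)) N (\<lambda>a. mon a x) = (\<Sum>s\<le>\<tau>. qform (tuples (t + 1)) (Z s) (\<lambda>a. wmon s a x)))"

definition matrix_cert :: "nat \<Rightarrow> nat \<Rightarrow> ('n::finite, complex) tmat \<Rightarrow> ('n, complex) tmat \<Rightarrow>
    (nat \<Rightarrow> ('n, complex) tmat) \<Rightarrow> bool" where
  "matrix_cert t \<tau> N B W \<longleftrightarrow> N = (\<lambda>a b. B a b + (\<Sum>s\<le>\<tau>. W s a b)) \<and>
     B \<in> BS_perp (t + 1) \<and> (\<forall>s\<le>\<tau>. W s \<in> \<W> t s)"

text \<open>Take as \<open>B\<close> what remains of \<open>N\<close> after subtracting the partial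
  transposes of the \<open>Z s\<close>; the certificate says that the form of this remainder
  vanishes.\<close>

lemma matrix_cert_if_gram_cert:
  assumes "N \<in> Herm (t + 1)" "\<tau> \<le> t" "gram_cert t \<tau> N Z"
  shows "\<exists>B W. matrix_cert t \<tau> N B W"
proof -
  define W where "W s = ptranspose t s (Z s)" for s
  define B where "B = (\<lambda>a b. N a b - (\<Sum>s\<le>\<tau>. W s a b))"
  have psd: "psd (t + 1) (Z s)" if "s \<le> \<tau>" for s using assms(3) that by (simp add: gram_cert_def)
  have ptW: "ptranspose t s (W s) = Z s" if "s \<le> \<tau>" for s
    unfolding W_def using psd[OF that] assms(2) that by (intro ptranspose_ptranspose) (auto simp: psd_def)
  have WH: "W s \<in> Herm (t + 1)" if "s \<le> \<tau>" for s
    unfolding W_def using psd[OF that] by (intro ptranspose_Herm) (simp add: psd_def)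
  have "B \<in> BS_perp (t + 1)"
  proof (rule BS_perp_if_form_eq_0)
    show "B \<in> Herm (t + 1)"
    proof (rule HermI)
      fix a b :: "'a list"
      have "(\<Sum>s\<le>\<tau>. W s a b) = (\<Sum>s\<le>\<tau>. cnj (W s b a))"
        by (intro sum.cong refl HermD(1)[OF WH]) simp
      then show "B a b = cnj (B b a)"
        unfolding B_def complex_cnj_diff cnj_sum HermD(1)[OF assms(1), symmetric] by simp
      assume "a \<notin> tuples (t + 1) \<or> b \<notin> tuples (t + 1)"
      then show "B a b = 0"
        unfolding B_def using HermD(2)[OF assms(1)] HermD(2)[OF WH] by simp
    qed
    fix x
    have "qform (tuples (t + 1)) (W s) (\<lambda>a. mon a x) = qform (tuples (t + 1)) (Z s) (\<lambda>a. wmon s a x)"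
      if "s \<le> \<tau>" for s
      using qform_ptranspose[of s t "W s" x] assms(2) that by (simp add: ptW)
    then show "qform (tuples (t + 1)) B (\<lambda>a. mon a x) = 0"
      using assms(3) unfolding B_def qform_diff_sum gram_cert_def by simp
  qed
  moreover have "W s \<in> \<W> t s" if "s \<le> \<tau>" for s
    using WH[OF that] ptW[OF that] psd[OF that] by (simp add: \<W>_def)
  ultimately show ?thesis
    by (intro exI[of _ B] exI[of _ W]) (simp add: matrix_cert_def B_def)
qed

lemma gram_cert_if_matrix_cert:
  assumes "\<tau> \<le> t" "matrix_cert t \<tau> N B W"
  shows "gram_cert t \<tau> N (\<lambda>s. ptranspose t s (W s))"
proof -
  have "qform (tuples (t + 1)) N (\<lambda>a. mon a x) =
     (\<Sum>s\<le>\<tau>. qform (tuples (t + 1)) (ptranspose t s (W s)) (\<lambda>a. wmon s a x))" for x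
  proof -
    have B: "B = (\<lambda>a b. N a b - (\<Sum>s\<le>\<tau>. W s a b))"
      using assms(2) by (simp add: matrix_cert_def)
    have "qform (tuples (t + 1)) B (\<lambda>a. mon a x) = 0"
      using assms(2) by (intro BS_perp_form_eq_0) (simp add: matrix_cert_def)
    then have "qform (tuples (t + 1)) N (\<lambda>a. mon a x) = (\<Sum>s\<le>\<tau>. qform (tuples (t + 1)) (W s) (\<lambda>a. mon a x))"
      unfolding B qform_diff_sum by simp
    also have "\<dots> = (\<Sum>s\<le>\<tau>. qform (tuples (t + 1)) (ptranspose t s (W s)) (\<lambda>a. wmon s a x))"
      using assms(1) by (intro sum.cong refl qform_ptranspose[symmetric]) simp
    finally show ?thesis .
  qed
  then show ?thesis using assms(2) by (simp add: gram_cert_def matrix_cert_def \<W>_def)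
qed

text \<open>Weak duality: \<open>B\<close> pairs to 0 with a Bose symmetric extension, and partial
  transposition of both arguments turns the pairing with \<open>W s\<close> into one of positive
  semidefinite matrices.\<close>

lemma DPS_dual_if_matrix_cert:
  assumes "t \<ge> 1" "M \<in> Herm 2" "matrix_cert t ((t + 1) div 2) (tensor 2 M (id_mat (t - 1))) B W"
  shows "M \<in> DPS_dual t"
proof -
  define N where "N = tensor 2 M (id_mat (t - 1))"
  have B: "B = (\<lambda>a b. N a b - (\<Sum>s\<le>(t + 1) div 2. W s a b))" "B \<in> BS_perp (t + 1)"
    and W: "\<And>s. s \<le> (t + 1) div 2 \<Longrightarrow> W s \<in> \<W> t s"
    using assms(3) by (auto simp: matrix_cert_def N_def)
  have "0 \<le> hs_inner 2 M \<sigma>" if "\<sigma> \<in> DPS t" for \<sigma>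
  proof -
    from that obtain \<rho> where \<rho>: "\<rho> \<in> BS (t + 1)" "\<sigma> = ptrace t \<rho>"
      and pos: "\<And>s. s \<le> (t + 1) div 2 \<Longrightarrow> psd (t + 1) (ptranspose t s \<rho>)"
      by (auto simp: DPS_def)
    have "hs_inner (t + 1) B \<rho> = 0" using B(2) \<rho>(1) by (simp add: BS_perp_def)
    then have "hs_inner 2 M \<sigma> = (\<Sum>s\<le>(t + 1) div 2. hs_inner (t + 1) (W s) \<rho>)"
      unfolding \<rho>(2) hs_inner_ptrace[OF assms(1)] N_def[symmetric] B(1) hs_inner_diff_sum by simp
    also have "\<dots> = (\<Sum>s\<le>(t + 1) div 2. hs_inner (t + 1) (ptranspose t s (W s)) (ptranspose t s \<rho>))"
      using assms(1) by (intro sum.cong refl hs_inner_ptranspose[symmetric]) auto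
    also have "0 \<le> \<dots>"
      using W pos by (intro sum_nonneg hs_inner_pos_form_nonneg) (auto simp: psd_iff \<W>_def)
    finally show ?thesis .
  qed
  then show ?thesis using assms(2) by (simp add: DPS_dual_def)
qed

text \<open>All these forms lie in the span of the functions \<open>cnj (mon a x) * mon b x\<close>,
  so interpolation of this finite family applies. It provides the finite point set that
  \<open>gram_cone_duality\<close> needs.\<close>

lemma unisolvent_points:
  "\<exists>E :: ('n::finite \<Rightarrow> complex) set. finite E \<and>
     (\<forall>X. (\<forall>x\<in>E. qform (tuples k) X (\<lambda>a. mon a x) = 0) \<longrightarrow> (\<forall>x. qform (tuples k) X (\<lambda>a. mon a x) = 0))"
proof -
  define A where "A = (tuples k \<times> tuples k :: ('n list \<times> 'n list) set)"
  define u :: "'n list \<times> 'n list \<Rightarrow> ('n \<Rightarrow> complex) \<Rightarrow> complex"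
    where "u = (\<lambda>(a, b) x. cnj (mon a x) * mon b x)"
  have "finite A" by (simp add: A_def)
  from finite_family_interpolation[OF this, of UNIV u] obtain E lam where E: "finite E"
    and lam: "\<And>q y. q \<in> A \<Longrightarrow> u q y = (\<Sum>p\<in>A. (\<Sum>x\<in>E. lam p x * u q x) * u p y)"
    by blast
  have qf: "qform (tuples k) X (\<lambda>a. mon a x) = (\<Sum>q\<in>A. X (fst q) (snd q) * u q x)" for X x
    by (simp add: qform_def A_def u_def sum.cartesian_product' case_prod_beta mult_ac)
  have "qform (tuples k) X (\<lambda>a. mon a y) = 0" if zero: "\<forall>x\<in>E. qform (tuples k) X (\<lambda>a. mon a x) = 0" for X y
  proof -
    have "qform (tuples k) X (\<lambda>a. mon a y) =
        (\<Sum>q\<in>A. X (fst q) (snd q) * (\<Sum>p\<in>A. (\<Sum>x\<in>E. lam p x * u q x) * u p y))"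
      unfolding qf by (intro sum.cong refl arg_cong2[of _ _ _ _ "(*)"] lam)
    also have "\<dots> = (\<Sum>q\<in>A. \<Sum>p\<in>A. \<Sum>x\<in>E. lam p x * (X (fst q) (snd q) * u q x) * u p y)"
      by (simp add: sum_distrib_left sum_distrib_right mult_ac)
    also have "\<dots> = (\<Sum>p\<in>A. \<Sum>x\<in>E. \<Sum>q\<in>A. lam p x * (X (fst q) (snd q) * u q x) * u p y)"
      by (subst sum.swap) (simp add: sum.swap[of _ E A])
    also have "\<dots> = (\<Sum>p\<in>A. \<Sum>x\<in>E. lam p x * qform (tuples k) X (\<lambda>a. mon a x) * u p y)"
      unfolding qf by (simp add: sum_distrib_left sum_distrib_right)
    also have "\<dots> = 0" using zero by simp
    finally show ?thesis .
  qed
  then show ?thesis using E by blast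
qed

text \<open>Partial transposition keeps each \<open>ketbra\<close> of rank one, now built from the
  vector with entries \<open>wmon s a x\<close>. The form thus becomes the weighted sum of squared
  moduli tested in \<open>gram_cone_duality\<close>.\<close>

lemma ptranspose_ketbra_sum:
  assumes "s \<le> t"
  shows "qform (tuples (t + 1)) (ptranspose t s (\<lambda>a b. \<Sum>x\<in>E. of_real (r x) * ketbra (t + 1) x a b)) v =
    of_real (\<Sum>x\<in>E. r x * (cmod (\<Sum>a\<in>tuples (t + 1). cnj (v a) * wmon s a x))\<^sup>2)"
proof -
  have pt: "ptranspose t s (\<lambda>a b. \<Sum>x\<in>E. of_real (r x) * ketbra (t + 1) x a b) a b =
      (\<Sum>x\<in>E. of_real (r x) * (wmon s a x * cnj (wmon s b x)))"
    if "a \<in> tuples (t + 1)" "b \<in> tuples (t + 1)" for a b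
    using conj_swap_tuples[OF that assms] conj_swap_tuples[OF that(2,1) assms]
    unfolding ptranspose_apply[OF that]
    by (simp add: ketbra_def) (simp add: conj_swap_def wmon_def mult_ac)
  have "qform (tuples (t + 1)) (ptranspose t s (\<lambda>a b. \<Sum>x\<in>E. of_real (r x) * ketbra (t + 1) x a b)) v =
    (\<Sum>a\<in>tuples (t + 1). \<Sum>b\<in>tuples (t + 1). \<Sum>x\<in>E.
       of_real (r x) * ((cnj (v a) * wmon s a x) * cnj (cnj (v b) * wmon s b x)))"
    unfolding qform_def using pt
    by (intro sum.cong refl) (simp add: sum_distrib_left sum_distrib_right mult_ac)
  also have "\<dots> = (\<Sum>x\<in>E. \<Sum>a\<in>tuples (t + 1). \<Sum>b\<in>tuples (t + 1).
       of_real (r x) * ((cnj (v a) * wmon s a x) * cnj (cnj (v b) * wmon s b x)))"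
    by (simp only: sum.swap[of _ E])
  also have "\<dots> = (\<Sum>x\<in>E. of_real (r x) * ((\<Sum>a\<in>tuples (t + 1). cnj (v a) * wmon s a x) *
      cnj (\<Sum>a\<in>tuples (t + 1). cnj (v a) * wmon s a x)))"
    unfolding cnj_sum sum_product unfolding sum_distrib_left ..
  finally show ?thesis by (simp only: complex_norm_square of_real_sum of_real_mult)
qed

lemma gram_cert_if_DPS_dual:
  fixes M :: "('n::finite, complex) tmat"
  assumes "t \<ge> 1" "M \<in> DPS_dual t" "\<tau> = (t + 1) div 2"
  shows "\<exists>Z. gram_cert t \<tau> (tensor 2 M (id_mat (t - 1))) Z"
proof -
  let ?T = "tuples (t + 1) :: 'n list set"
  define N where "N = tensor 2 M (id_mat (t - 1))"
  have \<tau>: "\<tau> \<le> t" using assms by auto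
  have NH: "N \<in> Herm (t + 1)"
    using tensor_id_mat_Herm[of M 2 "t - 1"] assms(1,2) by (simp add: N_def DPS_dual_def)
  obtain E :: "('n \<Rightarrow> complex) set" where E: "finite E"
    and uni: "\<And>X x. (\<And>x. x \<in> E \<Longrightarrow> qform ?T X (\<lambda>a. mon a x) = 0) \<Longrightarrow> qform ?T X (\<lambda>a. mon a x) = 0"
    using unisolvent_points[of "t + 1"] by blast
  define p where "p x = Re (qform ?T N (\<lambda>a. mon a x))" for x
  have p: "of_real (p x) = qform ?T N (\<lambda>a. mon a x)" for x
  proof -
    have "cnj (qform ?T N (\<lambda>a. mon a x)) = (\<Sum>a\<in>?T. \<Sum>b\<in>?T. cnj (mon b x) * cnj (N a b) * mon a x)"
      by (simp add: qform_def mult_ac)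
    also have "\<dots> = (\<Sum>a\<in>?T. \<Sum>b\<in>?T. cnj (mon b x) * N b a * mon a x)"
      unfolding HermD(1)[OF NH, symmetric] ..
    also have "\<dots> = qform ?T N (\<lambda>a. mon a x)" unfolding qform_def by (rule sum.swap)
    finally show ?thesis by (simp add: p_def complex_eq_iff)
  qed
  have "\<exists>Z. (\<forall>s\<in>{..\<tau>}. pos_form ?T (Z s)) \<and>
      (\<forall>x\<in>E. of_real (p x) = (\<Sum>s\<in>{..\<tau>}. qform ?T (Z s) (\<lambda>a. wmon s a x)))"
  proof (rule gram_cone_duality)
    fix r :: "('n \<Rightarrow> complex) \<Rightarrow> real"
    assume r: "\<And>s v. s \<in> {..\<tau>} \<Longrightarrow> 0 \<le> (\<Sum>x\<in>E. r x * (cmod (\<Sum>a\<in>?T. v a * wmon s a x))\<^sup>2)"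
    \<comment> \<open>For this signed combination, the assumption on \<open>r\<close> is exactly
      positivity of all the partial transposes, so its partial trace lies in
      \<open>DPS t\<close>.\<close>
    define \<rho> where "\<rho> = (\<lambda>a b. \<Sum>x\<in>E. of_real (r x) * ketbra (t + 1) x a b)"
    have BS: "\<rho> \<in> BS (t + 1)" unfolding \<rho>_def by (rule BS_if_sum_ketbra)
    then have H: "\<rho> \<in> Herm (t + 1)" by (simp add: BS_def)
    have "psd (t + 1) (ptranspose t s \<rho>)" if "s \<le> \<tau>" for s
      unfolding psd_iff pos_form_def
    proof (intro conjI allI)
      show "ptranspose t s \<rho> \<in> Herm (t + 1)" using H by (rule ptranspose_Herm)
      fix v
      show "0 \<le> qform ?T (ptranspose t s \<rho>) v"
        unfolding \<rho>_def using that \<tau> r[of s "\<lambda>a. cnj (v a)"]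
        by (subst ptranspose_ketbra_sum) (auto simp: less_eq_complex_def)
    qed
    then have "ptrace t \<rho> \<in> DPS t"
      using BS ptrace_Herm[OF H] assms(3) by (auto simp: DPS_def)
    then have "0 \<le> hs_inner 2 M (ptrace t \<rho>)" using assms(2) by (auto simp: DPS_dual_def)
    also have "hs_inner 2 M (ptrace t \<rho>) = hs_inner (t + 1) N \<rho>"
      unfolding N_def by (rule hs_inner_ptrace[OF assms(1)])
    also have "\<dots> = (\<Sum>x\<in>E. of_real (r x) * hs_inner (t + 1) N (ketbra (t + 1) x))"
      unfolding hs_inner_def \<rho>_def
      by (simp add: sum_distrib_left sum.swap[of _ E] mult_ac)
    also have "\<dots> = of_real (\<Sum>x\<in>E. r x * p x)"
      by (simp only: hs_inner_ketbra[OF NH] p of_real_sum of_real_mult)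
    finally show "0 \<le> (\<Sum>x\<in>E. r x * p x)" by (simp add: less_eq_complex_def)
  qed (use E in auto)
  then obtain Z where Z: "\<And>s. s \<le> \<tau> \<Longrightarrow> pos_form ?T (Z s)"
    and pZ: "\<And>x. x \<in> E \<Longrightarrow> of_real (p x) = (\<Sum>s\<le>\<tau>. qform ?T (Z s) (\<lambda>a. wmon s a x))"
    by auto
  \<comment> \<open>Membership in \<open>Herm\<close> requires zero entries off the tuples, and the
    form does not see those entries.\<close>
  define Y where "Y s a b = (if a \<in> ?T \<and> b \<in> ?T then Z s a b else 0)" for s a b
  have qY: "qform ?T (Y s) v = qform ?T (Z s) v" for s v
    by (simp add: qform_def Y_def cong: sum.cong)
  have psdY: "psd (t + 1) (Y s)" if "s \<le> \<tau>" for s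
  proof -
    have "Y s a b = cnj (Y s b a)" if "a \<in> ?T" "b \<in> ?T" for a b
      using pos_form_hermitian[OF Z[OF \<open>s \<le> \<tau>\<close>] finite_tuples that] that by (simp add: Y_def)
    then have "Y s \<in> Herm (t + 1)" by (rule HermI[rotated]) (auto simp: Y_def)
    then show ?thesis using Z[OF that] unfolding psd_iff pos_form_def qY by blast
  qed
  \<comment> \<open>The identity is known only on \<open>E\<close>. It is the vanishing of the form
    of a single matrix, so unisolvence extends it to all \<open>x\<close>.\<close>
  define B where "B = (\<lambda>a b. N a b - (\<Sum>s\<le>\<tau>. ptranspose t s (Y s) a b))"
  have B: "qform ?T B (\<lambda>a. mon a x) = qform ?T N (\<lambda>a. mon a x) - (\<Sum>s\<le>\<tau>. qform ?T (Y s) (\<lambda>a. wmon s a x))" for x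
  proof -
    have "qform ?T (ptranspose t s (Y s)) (\<lambda>a. mon a x) = qform ?T (Y s) (\<lambda>a. wmon s a x)" if "s \<le> \<tau>" for s
      using qform_ptranspose[of s t "ptranspose t s (Y s)" x] psdY[OF that] that \<tau>
      by (simp add: ptranspose_ptranspose psd_def)
    then show ?thesis unfolding B_def qform_diff_sum by simp
  qed
  have "qform ?T B (\<lambda>a. mon a x) = 0" for x
  proof (rule uni)
    fix x assume "x \<in> E"
    show "qform ?T B (\<lambda>a. mon a x) = 0" unfolding B qY pZ[OF \<open>x \<in> E\<close>, symmetric] p by (rule diff_self)
  qed
  then show ?thesis using psdY unfolding N_def[symmetric] gram_cert_def B by auto
qed

section \<open>Passing between Gram certificates and sums of squares\<close>

lemma r_sos_if_gram_cert:
  fixes f :: "'n::finite cpoly"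
  assumes "gram_cert t \<tau> N Z" "\<And>x. ev f x = qform (tuples (t + 1)) N (\<lambda>a. mon a x)"
  shows "r_sos f"
proof -
  let ?T = "tuples (t + 1) :: 'n list set"
  have "\<forall>s. \<exists>(m::nat) g. s \<le> \<tau> \<longrightarrow> (\<forall>a\<in>?T. \<forall>b\<in>?T. Z s a b = (\<Sum>l<m. g l a * cnj (g l b)))"
  proof
    fix s
    show "\<exists>(m::nat) g. s \<le> \<tau> \<longrightarrow> (\<forall>a\<in>?T. \<forall>b\<in>?T. Z s a b = (\<Sum>l<m. g l a * cnj (g l b)))"
    proof (cases "s \<le> \<tau>")
      case True
      then have "pos_form ?T (Z s)" using assms(1) by (simp add: gram_cert_def psd_iff)
      from pos_form_factor[OF finite_tuples this] show ?thesis by blast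
    qed simp
  qed
  then have "\<exists>(m :: nat \<Rightarrow> nat) g. \<forall>s\<le>\<tau>. \<forall>a\<in>?T. \<forall>b\<in>?T. Z s a b = (\<Sum>l<m s. g s l a * cnj (g s l b))"
    by (simp only: choice_iff)
  then obtain m :: "nat \<Rightarrow> nat" and g where g: "\<And>s a b. s \<le> \<tau> \<Longrightarrow> a \<in> ?T \<Longrightarrow> b \<in> ?T \<Longrightarrow> Z s a b = (\<Sum>l<m s. g s l a * cnj (g s l b))"
    by blast
  \<comment> \<open>Each vector in the rank-one factorization of \<open>Z s\<close> becomes a
    polynomial whose squared modulus is one term of the form.\<close>
  define h where "h = (\<lambda>(s, l). \<Sum>a\<in>?T. Const (cnj (g s l a)) * wmon_poly s a)"
  have "f = (\<Sum>q\<in>Sigma {..\<tau>} (\<lambda>s. {..<m s}). h q * conj_poly (h q))"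
  proof (rule ev_inject)
    fix x
    have "ev f x = (\<Sum>s\<le>\<tau>. qform ?T (Z s) (\<lambda>a. wmon s a x))"
      using assms by (simp add: gram_cert_def)
    also have "\<dots> = (\<Sum>s\<le>\<tau>. \<Sum>l<m s. of_real ((cmod (\<Sum>a\<in>?T. cnj (g s l a) * wmon s a x))\<^sup>2))"
      by (intro sum.cong refl qform_rank_one_sum g) auto
    also have "\<dots> = (\<Sum>s\<le>\<tau>. \<Sum>l<m s. ev (h (s, l) * conj_poly (h (s, l))) x)"
      by (simp only: h_def prod.case ev_mult ev_conj_poly ev_sum ev_wmon_poly ev_Const complex_norm_square)
    also have "\<dots> = ev (\<Sum>q\<in>Sigma {..\<tau>} (\<lambda>s. {..<m s}). h q * conj_poly (h q)) x"
      by (simp add: ev_sum sum.Sigma)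
    finally show "ev f x = ev (\<Sum>q\<in>Sigma {..\<tau>} (\<lambda>s. {..<m s}). h q * conj_poly (h q)) x" .
  qed
  then show ?thesis using r_sos_sum_norm_squares[of "Sigma {..\<tau>} (\<lambda>s. {..<m s})" h] by simp
qed

lemma mon_scale: "mon a (\<lambda>i. z * x i) = z ^ length a * mon a x"
  by (induction a) (simp_all add: mult_ac)

lemma gram_cert_if_r_sos:
  fixes f :: "'n::finite cpoly"
  assumes "t \<ge> 1" "\<tau> = (t + 1) div 2" "r_sos f"
    and f: "\<And>x. ev f x = qform (tuples (t + 1)) N (\<lambda>a. mon a x)"
  shows "\<exists>Z. gram_cert t \<tau> N Z"
proof -
  let ?T = "tuples (t + 1) :: 'n list set"
  define k where "k = t + 1"
  obtain m :: nat and q where herm: "\<And>l. l < m \<Longrightarrow> hermitian_poly (q l)" and fq: "f = (\<Sum>l<m. (q l)\<^sup>2)"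
    using assms(3) by (auto simp: r_sos_def)
  have P: "ev f x = (\<Sum>l<m. (ev (q l) x)\<^sup>2)" for x by (simp add: fq ev_sum ev_power)
  have hom: "ev f (\<lambda>i. z * x i) = (z * cnj z) ^ k * ev f x" for z x
    unfolding f qform_def sum_distrib_left
    by (intro sum.cong refl) (simp add: mon_scale tuples_def k_def power_mult_distrib mult_ac)
  define F where "F l s x = (cmod (bidegree_part (q l) (k - s) s x))\<^sup>2" for l s x
  \<comment> \<open>The number of bidegrees folded onto \<open>s\<close>: two if
    \<open>2 * s < k\<close>, one if \<open>2 * s = k\<close>.\<close>
  define c where "c s = card {i. i \<le> k \<and> min i (k - i) = s}" for s
  \<comment> \<open>Conjugation exchanges the bidegrees \<open>(i, k - i)\<close> and \<open>(k - i, i)\<close>, so those with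
    \<open>k - i \<le> \<tau>\<close> suffice.\<close>
  have fold: "(\<Sum>i\<le>k. (cmod (bidegree_part (q l) i (k - i) x))\<^sup>2) = (\<Sum>s\<le>\<tau>. real (c s) * F l s x)"
    if "l < m" for l x
  proof -
    have "(\<Sum>i\<le>k. (cmod (bidegree_part (q l) i (k - i) x))\<^sup>2) =
       (\<Sum>s\<le>\<tau>. \<Sum>i | i \<in> {..k} \<and> min i (k - i) = s. (cmod (bidegree_part (q l) i (k - i) x))\<^sup>2)"
      using assms(2) by (intro sum.group[symmetric]) (auto simp: k_def)
    also have "\<dots> = (\<Sum>s\<le>\<tau>. \<Sum>i | i \<in> {..k} \<and> min i (k - i) = s. F l s x)"
    proof (intro sum.cong refl)
      fix s i assume "i \<in> {i \<in> {..k}. min i (k - i) = s}"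
      then have i: "i \<le> k" "s = i \<or> s = k - i" by auto
      have "cmod (bidegree_part (q l) i (k - i) x) = cmod (bidegree_part (q l) (k - i) i x)"
        using cnj_bidegree_part[OF herm[OF that], of i "k - i" x] by (metis complex_mod_cnj)
      then show "(cmod (bidegree_part (q l) i (k - i) x))\<^sup>2 = F l s x"
        using i by (auto simp: F_def)
    qed
    finally show ?thesis by (simp add: c_def)
  qed
  have "\<forall>l s. \<exists>v. s \<le> \<tau> \<longrightarrow> (\<forall>x. bidegree_part (q l) (k - s) s x = (\<Sum>a\<in>?T. v a * wmon s a x))"
  proof (intro allI)
    fix l s
    show "\<exists>v. s \<le> \<tau> \<longrightarrow> (\<forall>x. bidegree_part (q l) (k - s) s x = (\<Sum>a\<in>?T. v a * wmon s a x))"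
    proof (cases "s \<le> \<tau>")
      case True
      then have "s < k" using assms(1,2) by (auto simp: k_def)
      from bidegree_part_eq_sum_wmon[OF this, of "q l"] show ?thesis by (auto simp: k_def)
    qed simp
  qed
  then obtain v where v: "\<And>l s x. s \<le> \<tau> \<Longrightarrow> bidegree_part (q l) (k - s) s x = (\<Sum>a\<in>?T. v l s a * wmon s a x)"
    by (simp only: choice_iff) blast
  \<comment> \<open>The square root moves the multiplicity \<open>c s\<close> inside the squared
    modulus; the conjugate matches the convention of \<open>qform_rank_one_sum\<close>.\<close>
  define g where "g s l a = of_real (sqrt (c s)) * cnj (v l s a)" for s l a
  define Z where "Z s a b = (if a \<in> ?T \<and> b \<in> ?T then \<Sum>l<m. g s l a * cnj (g s l b) else 0)" for s a b
  have Zq: "qform ?T (Z s) u = (\<Sum>l<m. of_real ((cmod (\<Sum>a\<in>?T. cnj (g s l a) * u a))\<^sup>2))" for s u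
    by (rule qform_rank_one_sum) (simp add: Z_def)
  have "psd (t + 1) (Z s)" for s
    unfolding psd_iff
  proof
    show "Z s \<in> Herm (t + 1)" by (intro HermI) (auto simp: Z_def mult.commute)
    show "pos_form ?T (Z s)"
      unfolding pos_form_def Zq by (auto intro!: sum_nonneg simp: less_eq_complex_def simp flip: of_real_power)
  qed
  moreover have "qform ?T N (\<lambda>a. mon a x) = (\<Sum>s\<le>\<tau>. qform ?T (Z s) (\<lambda>a. wmon s a x))" for x
  proof -
    have "qform ?T N (\<lambda>a. mon a x) = (\<Sum>l<m. of_real (\<Sum>i\<le>k. (cmod (bidegree_part (q l) i (k - i) x))\<^sup>2))"
      using sos_bihomogeneous[OF herm P hom, of x] by (simp add: f)
    also have "\<dots> = (\<Sum>l<m. of_real (\<Sum>s\<le>\<tau>. real (c s) * F l s x))"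
      by (intro sum.cong refl arg_cong[of _ _ of_real] fold) simp
    also have "\<dots> = (\<Sum>s\<le>\<tau>. \<Sum>l<m. of_real (real (c s) * F l s x))"
      by (simp add: sum.swap[of _ "{..\<tau>}"])
    also have "\<dots> = (\<Sum>s\<le>\<tau>. qform ?T (Z s) (\<lambda>a. wmon s a x))"
      unfolding Zq
    proof (intro sum.cong refl arg_cong[of _ _ of_real])
      fix s l assume "s \<in> {..\<tau>}"
      have "(\<Sum>a\<in>?T. cnj (g s l a) * wmon s a x) = of_real (sqrt (c s)) * bidegree_part (q l) (k - s) s x"
        using v[of s l x] \<open>s \<in> _\<close> by (simp add: g_def sum_distrib_left mult.assoc)
      then show "real (c s) * F l s x = (cmod (\<Sum>a\<in>?T. cnj (g s l a) * wmon s a x))\<^sup>2"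
        by (simp add: F_def norm_mult power_mult_distrib)
    qed
    finally show ?thesis .
  qed
  ultimately show ?thesis unfolding gram_cert_def by blast
qed

theorem theorem4p1:
  fixes M :: "'n::finite list \<Rightarrow> 'n list \<Rightarrow> complex" and t \<tau> :: nat
  assumes "t \<ge> 1"
    and "M \<in> Herm 2"
    and "\<tau> = (t + 1) div 2"
  shows "(M \<in> DPS_dual t \<longleftrightarrow> r_sos (norm_sq_poly ^ (t - 1) * form_poly M)) \<and>
         (r_sos (norm_sq_poly ^ (t - 1) * form_poly M) \<longleftrightarrow>
           (\<exists>B W. B \<in> Herm (t + 1) \<and> (\<forall>s\<le>\<tau>. W s \<in> Herm (t + 1)) \<and>
              tensor 2 M (tensor_power (id_mat 1) (t - 1)) = (\<lambda>a b. B a b + (\<Sum>s\<le>\<tau>. W s a b)) \<and>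
              B \<in> BS_perp (t + 1) \<and> (\<forall>s\<le>\<tau>. W s \<in> \<W> t s)))"
proof -
  define N where "N = tensor 2 M (id_mat (t - 1))"
  define f where "f = norm_sq_poly ^ (t - 1) * form_poly M"
  have \<tau>: "\<tau> \<le> t" using assms by auto
  have NH: "N \<in> Herm (t + 1)"
    using tensor_id_mat_Herm[OF assms(2), of "t - 1"] assms(1) by (simp add: N_def)
  have f: "ev f x = qform (tuples (t + 1)) N (\<lambda>a. mon a x)" for x
    unfolding f_def ev_form_poly[OF assms(1)] N_def[symmetric] by (rule hs_inner_ketbra[OF NH])
  have "(\<exists>B W. matrix_cert t \<tau> N B W) \<longleftrightarrow> (\<exists>B W. B \<in> Herm (t + 1) \<and> (\<forall>s\<le>\<tau>. W s \<in> Herm (t + 1)) \<and>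
      tensor 2 M (tensor_power (id_mat 1) (t - 1)) = (\<lambda>a b. B a b + (\<Sum>s\<le>\<tau>. W s a b)) \<and>
      B \<in> BS_perp (t + 1) \<and> (\<forall>s\<le>\<tau>. W s \<in> \<W> t s))" (is "_ \<longleftrightarrow> ?iii")
    unfolding matrix_cert_def N_def[symmetric] tensor_power_id_mat
    by (intro iff_exI) (auto simp: BS_perp_def \<W>_def)
  moreover have "(\<exists>B W. matrix_cert t \<tau> N B W) \<longleftrightarrow> (\<exists>Z. gram_cert t \<tau> N Z)"
    using matrix_cert_if_gram_cert[OF NH \<tau>] gram_cert_if_matrix_cert[OF \<tau>] by blast
  moreover have "r_sos f \<longleftrightarrow> (\<exists>Z. gram_cert t \<tau> N Z)"
    using r_sos_if_gram_cert[OF _ f] gram_cert_if_r_sos[OF assms(1,3) _ f] by blast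
  \<comment> \<open>Duality leads from (i) to a Gram certificate and on to a matrix certificate;
    weak duality leads back.\<close>
  moreover have "M \<in> DPS_dual t \<longleftrightarrow> (\<exists>B W. matrix_cert t \<tau> N B W)"
    using gram_cert_if_DPS_dual[OF assms(1) _ assms(3), of M] matrix_cert_if_gram_cert[OF NH \<tau>]
      DPS_dual_if_matrix_cert[OF assms(1,2)]
    unfolding N_def assms(3) by blast
  ultimately show ?thesis unfolding f_def by blast
qed

end
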